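(* Let $\mathcal{G}=\mathcal{G}_1\oplus\mathcal{G}_2$ be a direct sum of finite-dimensional complex Lie algebras and let $\mathcal{V}$ be a finite-dimensional irreducible $\mathcal{G}$-module with $\dim\mathcal{V}>1$. Then there are finite-dimensional irreducible $\mathcal{G}_i$-modules $\mathcal{V}_i$ ($i=1,2$) such that $\mathcal{V}\cong\mathcal{V}_1\otimes\mathcal{V}_2$ as $\mathcal{G}$-modules.
   Context: All vector spaces and algebras are over $\mathbb{C}$. The direct sum $\mathcal{G}_1\oplus\mathcal{G}_2$ is a direct sum of ideals. Modules are right modules: $v.[g,h]=(v.g).h-(v.h).g$. The module $\mathcal{V}_1\otimes\mathcal{V}_2$ carries the $\mathcal{G}$-action $(v_1\otimes v_2).(x_1+x_2)=(v_1.x_1)\otimes v_2+v_1\otimes(v_2.x_2)$ for $x_i\in\mathcal{G}_i$, $v_i\in\mathcal{V}_i$. *)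

theory Defs
  imports "HOL-Algebra.AbelCoset" "Jordan_Normal_Form.VS_Connect"
begin

record ('k, 'g) lie_algebra = "('k, 'g) module" +
  bracket :: "'g \<Rightarrow> 'g \<Rightarrow> 'g"  (\<open>\<lblot>_, _\<rblot>\<index>\<close>)

record ('k, 'g, 'v) lie_module = "('k, 'v) module" +
  act :: "'v \<Rightarrow> 'g \<Rightarrow> 'v"  (infixl \<open>\<triangleleft>\<index>\<close> 70)

locale lie_algebra = vectorspace K L
  for K :: "('k, 'm) ring_scheme" and L :: "('k, 'g, 'n) lie_algebra_scheme" (structure) +
  assumes bracket_closed:
      "\<lbrakk>x \<in> carrier L; y \<in> carrier L\<rbrakk> \<Longrightarrow> \<lblot>x, y\<rblot> \<in> carrier L"
    and bracket_add_left:
      "\<lbrakk>x \<in> carrier L; y \<in> carrier L; z \<in> carrier L\<rbrakk> \<Longrightarrow> \<lblot>x \<oplus> y, z\<rblot> = \<lblot>x, z\<rblot> \<oplus> \<lblot>y, z\<rblot>"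
    and bracket_add_right:
      "\<lbrakk>x \<in> carrier L; y \<in> carrier L; z \<in> carrier L\<rbrakk> \<Longrightarrow> \<lblot>x, y \<oplus> z\<rblot> = \<lblot>x, y\<rblot> \<oplus> \<lblot>x, z\<rblot>"
    and bracket_smult_left:
      "\<lbrakk>c \<in> carrier K; x \<in> carrier L; y \<in> carrier L\<rbrakk> \<Longrightarrow> \<lblot>c \<odot> x, y\<rblot> = c \<odot> \<lblot>x, y\<rblot>"
    and bracket_smult_right:
      "\<lbrakk>c \<in> carrier K; x \<in> carrier L; y \<in> carrier L\<rbrakk> \<Longrightarrow> \<lblot>x, c \<odot> y\<rblot> = c \<odot> \<lblot>x, y\<rblot>"
    and bracket_self: "x \<in> carrier L \<Longrightarrow> \<lblot>x, x\<rblot> = \<zero>"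
    and jacobi:
      "\<lbrakk>x \<in> carrier L; y \<in> carrier L; z \<in> carrier L\<rbrakk>
        \<Longrightarrow> \<lblot>x, \<lblot>y, z\<rblot>\<rblot> \<oplus> \<lblot>y, \<lblot>z, x\<rblot>\<rblot> \<oplus> \<lblot>z, \<lblot>x, y\<rblot>\<rblot> = \<zero>"

locale lie_module = lie: lie_algebra K L + vectorspace K V
  for K :: "('k, 'm) ring_scheme" and L :: "('k, 'g, 'n) lie_algebra_scheme" (structure)
    and V :: "('k, 'g, 'v, 'p) lie_module_scheme" (structure) +
  assumes act_closed:
      "\<lbrakk>v \<in> carrier V; x \<in> carrier L\<rbrakk> \<Longrightarrow> v \<triangleleft>\<^bsub>V\<^esub> x \<in> carrier V"
    and act_add_left:
      "\<lbrakk>v \<in> carrier V; w \<in> carrier V; x \<in> carrier L\<rbrakk>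
        \<Longrightarrow> (v \<oplus>\<^bsub>V\<^esub> w) \<triangleleft>\<^bsub>V\<^esub> x = v \<triangleleft>\<^bsub>V\<^esub> x \<oplus>\<^bsub>V\<^esub> w \<triangleleft>\<^bsub>V\<^esub> x"
    and act_add_right:
      "\<lbrakk>v \<in> carrier V; x \<in> carrier L; y \<in> carrier L\<rbrakk>
        \<Longrightarrow> v \<triangleleft>\<^bsub>V\<^esub> (x \<oplus>\<^bsub>L\<^esub> y) = v \<triangleleft>\<^bsub>V\<^esub> x \<oplus>\<^bsub>V\<^esub> v \<triangleleft>\<^bsub>V\<^esub> y"
    and act_smult_left:
      "\<lbrakk>c \<in> carrier K; v \<in> carrier V; x \<in> carrier L\<rbrakk>
        \<Longrightarrow> (c \<odot>\<^bsub>V\<^esub> v) \<triangleleft>\<^bsub>V\<^esub> x = c \<odot>\<^bsub>V\<^esub> (v \<triangleleft>\<^bsub>V\<^esub> x)"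
    and act_smult_right:
      "\<lbrakk>c \<in> carrier K; v \<in> carrier V; x \<in> carrier L\<rbrakk>
        \<Longrightarrow> v \<triangleleft>\<^bsub>V\<^esub> (c \<odot>\<^bsub>L\<^esub> x) = c \<odot>\<^bsub>V\<^esub> (v \<triangleleft>\<^bsub>V\<^esub> x)"
    and act_bracket:
      "\<lbrakk>v \<in> carrier V; x \<in> carrier L; y \<in> carrier L\<rbrakk>
        \<Longrightarrow> v \<triangleleft>\<^bsub>V\<^esub> \<lblot>x, y\<rblot>\<^bsub>L\<^esub> = v \<triangleleft>\<^bsub>V\<^esub> x \<triangleleft>\<^bsub>V\<^esub> y \<ominus>\<^bsub>V\<^esub> v \<triangleleft>\<^bsub>V\<^esub> y \<triangleleft>\<^bsub>V\<^esub> x"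

definition lie_submodule where
  "lie_submodule K L W V \<longleftrightarrow>
     VectorSpace.subspace K W V \<and> (\<forall>w\<in>W. \<forall>x\<in>carrier L. w \<triangleleft>\<^bsub>V\<^esub> x \<in> W)"

definition irreducible_lie_module where
  "irreducible_lie_module K L V \<longleftrightarrow>
     lie_module K L V \<and> carrier V \<noteq> {\<zero>\<^bsub>V\<^esub>} \<and>
     (\<forall>W. lie_submodule K L W V \<longrightarrow> W = {\<zero>\<^bsub>V\<^esub>} \<or> W = carrier V)"

locale lie_module_iso = V: lie_module K L V + W: lie_module K L W + linear_map K V W f
  for K and L and V and W and f +
  assumes equivariant:
      "\<lbrakk>v \<in> carrier V; x \<in> carrier L\<rbrakk> \<Longrightarrow> f (v \<triangleleft>\<^bsub>V\<^esub> x) = f v \<triangleleft>\<^bsub>W\<^esub> x"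
    and bijective: "bij_betw f (carrier V) (carrier W)"

definition lie_module_isomorphic where
  "lie_module_isomorphic K L V W \<longleftrightarrow> (\<exists>f. lie_module_iso K L V W f)"

definition lie_ideal where
  "lie_ideal K I L \<longleftrightarrow>
     VectorSpace.subspace K I L \<and> (\<forall>x\<in>I. \<forall>y\<in>carrier L. \<lblot>x, y\<rblot>\<^bsub>L\<^esub> \<in> I)"

text \<open>The ideal \<open>I\<close> as a Lie algebra in its own right is \<open>L\<lparr>carrier := I\<rparr>\<close>.\<close>

locale lie_direct_sum = lie_algebra K L
  for K :: "('k, 'm) ring_scheme" and L :: "('k, 'g, 'n) lie_algebra_scheme" (structure)
    and I\<^sub>1 and I\<^sub>2 +
  assumes ideal1: "lie_ideal K I\<^sub>1 L"
    and ideal2: "lie_ideal K I\<^sub>2 L"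
    and int_zero: "I\<^sub>1 \<inter> I\<^sub>2 = {\<zero>}"
    and sum_eq: "I\<^sub>1 <+>\<^bsub>L\<^esub> I\<^sub>2 = carrier L"

text \<open>\<open>summand L I J x\<close> is the component in \<open>I\<close> of an element \<open>x\<close> of \<open>I \<oplus> J\<close>.\<close>

definition summand where
  "summand L I J x = (THE y. y \<in> I \<and> (\<exists>z\<in>J. x = y \<oplus>\<^bsub>L\<^esub> z))"

text \<open>The tensor product is the free vector space on the set \<open>V \<times> W\<close> modulo the subspace
  spanned by the bilinearity relations. In the module records below, the multiplicative
  fields inherited from rings carry no meaning.\<close>

definition free_space :: "('k, 'm) ring_scheme \<Rightarrow> 's set \<Rightarrow> ('k, 's \<Rightarrow> 'k) module" where
  "free_space K S =
     \<lparr>carrier = {f \<in> UNIV \<rightarrow> carrier K. finite {s. f s \<noteq> \<zero>\<^bsub>K\<^esub>} \<and> {s. f s \<noteq> \<zero>\<^bsub>K\<^esub>} \<subseteq> S},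
      mult = undefined, one = undefined,
      zero = (\<lambda>_. \<zero>\<^bsub>K\<^esub>), add = (\<lambda>f g s. f s \<oplus>\<^bsub>K\<^esub> g s),
      smult = (\<lambda>c f s. c \<otimes>\<^bsub>K\<^esub> f s)\<rparr>"

definition generator :: "('k, 'm) ring_scheme \<Rightarrow> 's \<Rightarrow> 's \<Rightarrow> 'k" where
  "generator K s = (\<lambda>t. if t = s then \<one>\<^bsub>K\<^esub> else \<zero>\<^bsub>K\<^esub>)"

definition quotient_space ::
    "('k, 'm) ring_scheme \<Rightarrow> ('k, 'v, 'n) module_scheme \<Rightarrow> 'v set \<Rightarrow> ('k, 'v set) module" where
  "quotient_space K V N =
     \<lparr>carrier = a_rcosets\<^bsub>V\<^esub> N, mult = undefined, one = undefined,
      zero = N, add = set_add V,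
      smult = (\<lambda>c X. \<Union>v\<in>X. N +>\<^bsub>V\<^esub> (c \<odot>\<^bsub>V\<^esub> v))\<rparr>"

definition bilinear_relations ::
    "('k, 'm) ring_scheme \<Rightarrow> ('k, 'v, 'n) module_scheme \<Rightarrow> ('k, 'w, 'p) module_scheme
      \<Rightarrow> ('v \<times> 'w \<Rightarrow> 'k) set" where
  "bilinear_relations K V W =
     (let F = free_space K (carrier V \<times> carrier W); \<delta> = generator K in
        {\<delta> (v \<oplus>\<^bsub>V\<^esub> v', w) \<ominus>\<^bsub>F\<^esub> (\<delta> (v, w) \<oplus>\<^bsub>F\<^esub> \<delta> (v', w)) | v v' w.
           v \<in> carrier V \<and> v' \<in> carrier V \<and> w \<in> carrier W}
      \<union> {\<delta> (v, w \<oplus>\<^bsub>W\<^esub> w') \<ominus>\<^bsub>F\<^esub> (\<delta> (v, w) \<oplus>\<^bsub>F\<^esub> \<delta> (v, w')) | v w w'.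
           v \<in> carrier V \<and> w \<in> carrier W \<and> w' \<in> carrier W}
      \<union> {\<delta> (c \<odot>\<^bsub>V\<^esub> v, w) \<ominus>\<^bsub>F\<^esub> c \<odot>\<^bsub>F\<^esub> \<delta> (v, w) | c v w.
           c \<in> carrier K \<and> v \<in> carrier V \<and> w \<in> carrier W}
      \<union> {\<delta> (v, c \<odot>\<^bsub>W\<^esub> w) \<ominus>\<^bsub>F\<^esub> c \<odot>\<^bsub>F\<^esub> \<delta> (v, w) | c v w.
           c \<in> carrier K \<and> v \<in> carrier V \<and> w \<in> carrier W})"

definition tensor_kernel ::
    "('k, 'm) ring_scheme \<Rightarrow> ('k, 'v, 'n) module_scheme \<Rightarrow> ('k, 'w, 'p) module_scheme
      \<Rightarrow> ('v \<times> 'w \<Rightarrow> 'k) set" where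
  "tensor_kernel K V W =
     LinearCombinations.module.span K (free_space K (carrier V \<times> carrier W)) (bilinear_relations K V W)"

definition tensor_space ::
    "('k, 'm) ring_scheme \<Rightarrow> ('k, 'v, 'n) module_scheme \<Rightarrow> ('k, 'w, 'p) module_scheme
      \<Rightarrow> ('k, ('v \<times> 'w \<Rightarrow> 'k) set) module" where
  "tensor_space K V W =
     quotient_space K (free_space K (carrier V \<times> carrier W)) (tensor_kernel K V W)"

definition pure_tensor ::
    "('k, 'm) ring_scheme \<Rightarrow> ('k, 'v, 'n) module_scheme \<Rightarrow> ('k, 'w, 'p) module_scheme
      \<Rightarrow> 'v \<Rightarrow> 'w \<Rightarrow> ('v \<times> 'w \<Rightarrow> 'k) set" where
  "pure_tensor K V W v w =
     tensor_kernel K V W +>\<^bsub>free_space K (carrier V \<times> carrier W)\<^esub> generator K (v, w)"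

text \<open>The action of \<open>x = x\<^sub>1 + x\<^sub>2\<close> on \<open>V\<^sub>1 \<otimes> V\<^sub>2\<close> extends
  \<open>v\<^sub>1 \<otimes> v\<^sub>2 \<mapsto> (v\<^sub>1 \<triangleleft> x\<^sub>1) \<otimes> v\<^sub>2 + v\<^sub>1 \<otimes> (v\<^sub>2 \<triangleleft> x\<^sub>2)\<close> linearly: a tensor \<open>X\<close> is a coset,
  each \<open>f \<in> X\<close> writes it as the sum of the \<open>f (v\<^sub>1, v\<^sub>2) (v\<^sub>1 \<otimes> v\<^sub>2)\<close>, and the union runs over equal
  values, one for each \<open>f \<in> X\<close>.\<close>

definition tensor_module ::
    "('k, 'm) ring_scheme \<Rightarrow> ('k, 'g, 'n) lie_algebra_scheme \<Rightarrow> 'g set \<Rightarrow> 'g set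
      \<Rightarrow> ('k, 'g, 'v, 'p) lie_module_scheme \<Rightarrow> ('k, 'g, 'w, 'q) lie_module_scheme
      \<Rightarrow> ('k, 'g, ('v \<times> 'w \<Rightarrow> 'k) set) lie_module" where
  "tensor_module K L I\<^sub>1 I\<^sub>2 V\<^sub>1 V\<^sub>2 =
     (let T = tensor_space K V\<^sub>1 V\<^sub>2; pt = pure_tensor K V\<^sub>1 V\<^sub>2 in
      module.extend T
       (lie_module.fields
         (\<lambda>X x. \<Union>f\<in>X. \<Oplus>\<^bsub>T\<^esub>p\<in>{p. f p \<noteq> \<zero>\<^bsub>K\<^esub>}.
            f p \<odot>\<^bsub>T\<^esub> (pt (fst p \<triangleleft>\<^bsub>V\<^sub>1\<^esub> summand L I\<^sub>1 I\<^sub>2 x) (snd p)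
                     \<oplus>\<^bsub>T\<^esub> pt (fst p) (snd p \<triangleleft>\<^bsub>V\<^sub>2\<^esub> summand L I\<^sub>2 I\<^sub>1 x)))))"

end

theory Submission
  imports "HOL-Computational_Algebra.Fundamental_Theorem_Algebra" Defs
begin

text \<open>Let \<open>U\<close> be a minimal nonzero \<open>G\<^sub>1\<close>-submodule of \<open>V\<close>. The space \<open>Hom(U, V)\<close> of
  \<open>G\<^sub>1\<close>-homomorphisms is a \<open>G\<^sub>2\<close>-module, because the actions of \<open>G\<^sub>1\<close> and \<open>G\<^sub>2\<close> on \<open>V\<close>
  commute, and evaluation \<open>U \<otimes> Hom(U, V) \<rightarrow> V\<close> is \<open>G\<close>-equivariant, hence onto since \<open>V\<close> is
  irreducible. By Schur's lemma a sum of images of linearly independent homomorphisms is direct, so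
  evaluation is injective. The same independence shows that a proper \<open>G\<^sub>2\<close>-submodule of
  \<open>Hom(U, V)\<close> would give a proper \<open>G\<close>-submodule of \<open>V\<close>.\<close>

section \<open>Transport of structure and quotients\<close>

text \<open>Both factors have to live on the element type of V, so both are cut out of V: U is a
  submodule, and Hom(U, V) becomes a subspace through evaluation at one nonzero vector. That
  evaluation is injective because an intertwiner vanishing at a nonzero vector of an irreducible
  module is zero. The second obstacle is the tensor product, a quotient record that comes with no
  proved structure. It is not studied on its own: the evaluation map is extended linearly to the
  free space, the fibres of this extension turn out to be the cosets of the relation space, and all
  structure is carried over from V. For this the kernel of the extension must be exactly the span of
  the bilinearity relations, and that is where independence over a basis of the multiplicity space
  is used. The complex numbers supply the eigenvector in Schur's lemma; it is found from a root of a
  polynomial of least degree that annihilates one vector. The two actions commute because the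
  bracket of elements of the two ideals lies in both of them.\<close>

lemma (in abelian_group) minus_add_cancel:
  assumes "a \<in> carrier G" and "b \<in> carrier G"
  shows "a \<ominus> b \<oplus> b = a" and "b \<oplus> (a \<ominus> b) = a"
proof -
  show "a \<ominus> b \<oplus> b = a"
    using assms by (simp add: a_minus_def a_assoc l_neg)
  then show "b \<oplus> (a \<ominus> b) = a"
    using assms by (simp add: a_comm)
qed

text \<open>Every element of \<open>Q\<close> is a value of \<open>q\<close>, so each axiom for
  \<open>Q\<close> is the image of the same axiom for \<open>V\<close>. Thus \<open>Q\<close> may be
  a bare record about which only the compatibility with \<open>q\<close> is known.\<close>

lemma linear_map_transport:
  assumes "vectorspace K V" and bij: "bij_betw q (carrier V) (carrier Q)"
    and add: "\<And>v w. \<lbrakk>v \<in> carrier V; w \<in> carrier V\<rbrakk> \<Longrightarrow> q (v \<oplus>\<^bsub>V\<^esub> w) = q v \<oplus>\<^bsub>Q\<^esub> q w"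
    and zero: "q \<zero>\<^bsub>V\<^esub> = \<zero>\<^bsub>Q\<^esub>"
    and smult: "\<And>c v. \<lbrakk>c \<in> carrier K; v \<in> carrier V\<rbrakk> \<Longrightarrow> q (c \<odot>\<^bsub>V\<^esub> v) = c \<odot>\<^bsub>Q\<^esub> q v"
  shows "linear_map K V Q q"
proof -
  interpret V: vectorspace K V by fact
  have im: "carrier Q = q ` carrier V"
    using bij by (simp add: bij_betw_def)
  have "vectorspace K Q"
  proof (rule vs_criteria)
    show "field K" ..
    show "\<zero>\<^bsub>Q\<^esub> \<in> carrier Q"
      unfolding im zero[symmetric] by simp
    show "\<forall>v w. v \<in> carrier Q \<and> w \<in> carrier Q \<longrightarrow> v \<oplus>\<^bsub>Q\<^esub> w \<in> carrier Q"
      unfolding im by (auto simp flip: add)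
    show "\<forall>v\<in>carrier Q. \<exists>w\<in>carrier Q. v \<oplus>\<^bsub>Q\<^esub> w = \<zero>\<^bsub>Q\<^esub>"
    proof
      fix v assume "v \<in> carrier Q"
      then obtain x where x: "x \<in> carrier V" "v = q x" by (auto simp: im)
      then have "v \<oplus>\<^bsub>Q\<^esub> q (\<ominus>\<^bsub>V\<^esub> x) = \<zero>\<^bsub>Q\<^esub>"
        by (simp flip: add zero add: V.r_neg)
      then show "\<exists>w\<in>carrier Q. v \<oplus>\<^bsub>Q\<^esub> w = \<zero>\<^bsub>Q\<^esub>"
        using x by (auto simp: im)
    qed
    show "\<forall>c v. c \<in> carrier K \<and> v \<in> carrier Q \<longrightarrow> c \<odot>\<^bsub>Q\<^esub> v \<in> carrier Q"
      unfolding im by (auto simp flip: smult)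
    show "\<forall>v w. v \<in> carrier Q \<and> w \<in> carrier Q \<longrightarrow> v \<oplus>\<^bsub>Q\<^esub> w = w \<oplus>\<^bsub>Q\<^esub> v"
      unfolding im by (auto simp flip: add simp: V.a_comm)
    show "\<forall>v w x. v \<in> carrier Q \<and> w \<in> carrier Q \<and> x \<in> carrier Q \<longrightarrow>
        v \<oplus>\<^bsub>Q\<^esub> w \<oplus>\<^bsub>Q\<^esub> x = v \<oplus>\<^bsub>Q\<^esub> (w \<oplus>\<^bsub>Q\<^esub> x)"
      unfolding im by (auto simp flip: add simp: V.a_assoc)
    show "\<forall>v\<in>carrier Q. v \<oplus>\<^bsub>Q\<^esub> \<zero>\<^bsub>Q\<^esub> = v"
      unfolding im by (auto simp flip: add zero)
    show "\<forall>a b v. a \<in> carrier K \<and> b \<in> carrier K \<and> v \<in> carrier Q \<longrightarrow>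
        (a \<otimes>\<^bsub>K\<^esub> b) \<odot>\<^bsub>Q\<^esub> v = a \<odot>\<^bsub>Q\<^esub> (b \<odot>\<^bsub>Q\<^esub> v)"
      unfolding im by (auto simp flip: smult simp: V.smult_assoc1)
    show "\<forall>v\<in>carrier Q. \<one>\<^bsub>K\<^esub> \<odot>\<^bsub>Q\<^esub> v = v"
      unfolding im by (auto simp flip: smult)
    show "\<forall>a b v. a \<in> carrier K \<and> b \<in> carrier K \<and> v \<in> carrier Q \<longrightarrow>
        (a \<oplus>\<^bsub>K\<^esub> b) \<odot>\<^bsub>Q\<^esub> v = a \<odot>\<^bsub>Q\<^esub> v \<oplus>\<^bsub>Q\<^esub> b \<odot>\<^bsub>Q\<^esub> v"
      unfolding im by (auto simp flip: smult add simp: V.smult_l_distr)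
    show "\<forall>a v w. a \<in> carrier K \<and> v \<in> carrier Q \<and> w \<in> carrier Q \<longrightarrow>
        a \<odot>\<^bsub>Q\<^esub> (v \<oplus>\<^bsub>Q\<^esub> w) = a \<odot>\<^bsub>Q\<^esub> v \<oplus>\<^bsub>Q\<^esub> a \<odot>\<^bsub>Q\<^esub> w"
      unfolding im by (auto simp flip: smult add simp: V.smult_r_distr)
  qed
  then show ?thesis
    using assms(1) bij add smult
    by (auto simp: linear_map_def mod_hom_def mod_hom_axioms_def LinearCombinations.module_hom_def vectorspace_def
        bij_betw_def)
qed

lemma lie_module_iso_transport:
  assumes "lie_module K L V" and bij: "bij_betw q (carrier V) (carrier Q)"
    and add: "\<And>v w. \<lbrakk>v \<in> carrier V; w \<in> carrier V\<rbrakk> \<Longrightarrow> q (v \<oplus>\<^bsub>V\<^esub> w) = q v \<oplus>\<^bsub>Q\<^esub> q w"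
    and zero: "q \<zero>\<^bsub>V\<^esub> = \<zero>\<^bsub>Q\<^esub>"
    and smult: "\<And>c v. \<lbrakk>c \<in> carrier K; v \<in> carrier V\<rbrakk> \<Longrightarrow> q (c \<odot>\<^bsub>V\<^esub> v) = c \<odot>\<^bsub>Q\<^esub> q v"
    and act: "\<And>v x. \<lbrakk>v \<in> carrier V; x \<in> carrier L\<rbrakk> \<Longrightarrow> q (v \<triangleleft>\<^bsub>V\<^esub> x) = q v \<triangleleft>\<^bsub>Q\<^esub> x"
  shows "lie_module_iso K L V Q q"
proof -
  interpret V: lie_module K L V by fact
  interpret q: linear_map K V Q q
    using V.vectorspace_axioms assms(2-5) by (rule linear_map_transport)
  have im: "carrier Q = q ` carrier V"
    using bij by (simp add: bij_betw_def)
  have "lie_module K L Q"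
  proof
    fix v x assume "v \<in> carrier Q" "x \<in> carrier L"
    then show "v \<triangleleft>\<^bsub>Q\<^esub> x \<in> carrier Q"
      by (auto simp: im V.act_closed simp flip: act)
  next
    fix v w x assume "v \<in> carrier Q" "w \<in> carrier Q" "x \<in> carrier L"
    then show "(v \<oplus>\<^bsub>Q\<^esub> w) \<triangleleft>\<^bsub>Q\<^esub> x = v \<triangleleft>\<^bsub>Q\<^esub> x \<oplus>\<^bsub>Q\<^esub> w \<triangleleft>\<^bsub>Q\<^esub> x"
      by (auto simp: im V.act_closed V.act_add_left simp flip: act q.f_add)
  next
    fix v x y assume "v \<in> carrier Q" "x \<in> carrier L" "y \<in> carrier L"
    then show "v \<triangleleft>\<^bsub>Q\<^esub> (x \<oplus>\<^bsub>L\<^esub> y) = v \<triangleleft>\<^bsub>Q\<^esub> x \<oplus>\<^bsub>Q\<^esub> v \<triangleleft>\<^bsub>Q\<^esub> y"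
      by (auto simp: im V.act_closed V.act_add_right simp flip: act q.f_add)
  next
    fix c v x assume "c \<in> carrier K" "v \<in> carrier Q" "x \<in> carrier L"
    then show "(c \<odot>\<^bsub>Q\<^esub> v) \<triangleleft>\<^bsub>Q\<^esub> x = c \<odot>\<^bsub>Q\<^esub> (v \<triangleleft>\<^bsub>Q\<^esub> x)"
      by (auto simp: im V.act_closed V.act_smult_left simp flip: act q.f_smult)
  next
    fix c v x assume "c \<in> carrier K" "v \<in> carrier Q" "x \<in> carrier L"
    then show "v \<triangleleft>\<^bsub>Q\<^esub> (c \<odot>\<^bsub>L\<^esub> x) = c \<odot>\<^bsub>Q\<^esub> (v \<triangleleft>\<^bsub>Q\<^esub> x)"
      by (auto simp: im V.act_closed V.act_smult_right simp flip: act q.f_smult)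
  next
    fix v x y assume "v \<in> carrier Q" "x \<in> carrier L" "y \<in> carrier L"
    then show "v \<triangleleft>\<^bsub>Q\<^esub> \<lblot>x, y\<rblot>\<^bsub>L\<^esub> = v \<triangleleft>\<^bsub>Q\<^esub> x \<triangleleft>\<^bsub>Q\<^esub> y \<ominus>\<^bsub>Q\<^esub> v \<triangleleft>\<^bsub>Q\<^esub> y \<triangleleft>\<^bsub>Q\<^esub> x"
      by (auto simp: im V.act_closed V.act_bracket V.lie.bracket_closed simp flip: act q.f_minus)
  qed
  then show ?thesis
    by (intro lie_module_iso.intro lie_module_iso_axioms.intro V.lie_module_axioms
        q.linear_map_axioms act bij)
qed

text \<open>The first isomorphism theorem read backwards: as \<open>N\<close> is the kernel of
  \<open>h\<close>, its cosets are the fibres of \<open>h\<close>. Sending \<open>z\<close> to its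
  fibre needs no representatives, and this direction is the one that
  \<open>linear_map_transport\<close> expects.\<close>

lemma quotient_space_fibers:
  assumes "linear_map K F Z h" and surj: "h ` carrier F = carrier Z"
    and N: "N = {g \<in> carrier F. h g = \<zero>\<^bsub>Z\<^esub>}"
  defines "q \<equiv> \<lambda>z. {g \<in> carrier F. h g = z}"
  shows "\<And>g. g \<in> carrier F \<Longrightarrow> N +>\<^bsub>F\<^esub> g = q (h g)"
    and "bij_betw q (carrier Z) (carrier (quotient_space K F N))"
    and "\<And>z w. \<lbrakk>z \<in> carrier Z; w \<in> carrier Z\<rbrakk> \<Longrightarrow> q (z \<oplus>\<^bsub>Z\<^esub> w) = q z \<oplus>\<^bsub>quotient_space K F N\<^esub> q w"
    and "q \<zero>\<^bsub>Z\<^esub> = \<zero>\<^bsub>quotient_space K F N\<^esub>"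
    and "\<And>c z. \<lbrakk>c \<in> carrier K; z \<in> carrier Z\<rbrakk> \<Longrightarrow> q (c \<odot>\<^bsub>Z\<^esub> z) = c \<odot>\<^bsub>quotient_space K F N\<^esub> q z"
proof -
  interpret F: vectorspace K F using assms(1) by (simp add: linear_map_def)
  interpret Z: vectorspace K Z using assms(1) by (simp add: linear_map_def)
  interpret h: linear_map K F Z h by fact
  have coset: "N +>\<^bsub>F\<^esub> g = q (h g)" if "g \<in> carrier F" for g
  proof (intro equalityI subsetI)
    fix x assume "x \<in> N +>\<^bsub>F\<^esub> g"
    then show "x \<in> q (h g)"
      using that by (auto simp: a_r_coset_def' N q_def)
  next
    fix x assume "x \<in> q (h g)"
    then have "x \<in> carrier F" "h x = h g" by (auto simp: q_def)
    then have "x \<ominus>\<^bsub>F\<^esub> g \<in> N" "x = x \<ominus>\<^bsub>F\<^esub> g \<oplus>\<^bsub>F\<^esub> g"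
      using that by (auto simp: N a_minus_def F.a_assoc F.l_neg Z.r_neg)
    then show "x \<in> N +>\<^bsub>F\<^esub> g"
      by (auto simp: a_r_coset_def')
  qed
  then show "\<And>g. g \<in> carrier F \<Longrightarrow> N +>\<^bsub>F\<^esub> g = q (h g)" .
  have "a_rcosets\<^bsub>F\<^esub> N = q ` h ` carrier F"
    using coset by (auto simp: A_RCOSETS_def' image_def)
  then have "carrier (quotient_space K F N) = q ` carrier Z"
    by (simp add: quotient_space_def surj)
  moreover have "inj_on q (carrier Z)"
  proof
    fix z w assume "z \<in> carrier Z" "w \<in> carrier Z" "q z = q w"
    moreover from \<open>z \<in> carrier Z\<close> obtain g where "g \<in> carrier F" "h g = z"
      unfolding surj[symmetric] by blast
    ultimately show "z = w" by (auto simp: q_def)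
  qed
  ultimately show "bij_betw q (carrier Z) (carrier (quotient_space K F N))"
    by (simp add: bij_betw_def)
  show "q \<zero>\<^bsub>Z\<^esub> = \<zero>\<^bsub>quotient_space K F N\<^esub>"
    by (simp add: quotient_space_def N q_def)
  show "q (z \<oplus>\<^bsub>Z\<^esub> w) = q z \<oplus>\<^bsub>quotient_space K F N\<^esub> q w"
    if z: "z \<in> carrier Z" and w: "w \<in> carrier Z" for z w
  proof -
    from z w obtain a where a: "a \<in> carrier F" "h a = z" unfolding surj[symmetric] by blast
    have "q (z \<oplus>\<^bsub>Z\<^esub> w) = set_add F (q z) (q w)"
    proof (intro equalityI subsetI)
      fix x assume "x \<in> q (z \<oplus>\<^bsub>Z\<^esub> w)"
      then have x: "x \<in> carrier F" "h x = z \<oplus>\<^bsub>Z\<^esub> w" by (auto simp: q_def)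
      then have "x \<ominus>\<^bsub>F\<^esub> a \<in> q w"
        using z w a by (simp add: q_def a_minus_def Z.a_ac Z.r_neg Z.r_neg1)
      moreover have "x = a \<oplus>\<^bsub>F\<^esub> (x \<ominus>\<^bsub>F\<^esub> a)"
        using a x by (simp add: F.minus_add_cancel)
      moreover have "a \<in> q z" using a by (simp add: q_def)
      ultimately show "x \<in> set_add F (q z) (q w)"
        by (auto simp: set_add_def')
    qed (auto simp: set_add_def' q_def)
    then show ?thesis by (simp add: quotient_space_def)
  qed
  show "q (c \<odot>\<^bsub>Z\<^esub> z) = c \<odot>\<^bsub>quotient_space K F N\<^esub> q z"
    if c: "c \<in> carrier K" and z: "z \<in> carrier Z" for c z
  proof -
    from z obtain a where a: "a \<in> carrier F" "h a = z" unfolding surj[symmetric] by blast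
    have "N +>\<^bsub>F\<^esub> (c \<odot>\<^bsub>F\<^esub> v) = q (c \<odot>\<^bsub>Z\<^esub> z)" if "v \<in> q z" for v
      using that c by (auto simp: q_def coset)
    \<comment> \<open>Scalar multiplication in the quotient is a union over the coset. All its
      members are equal, but the union has this common value only because the fibre is
      nonempty.\<close>
    moreover have "a \<in> q z" using a by (simp add: q_def)
    ultimately show ?thesis by (auto simp: quotient_space_def)
  qed
qed

section \<open>Tensor products\<close>

lemma free_space_simps [simp]:
  "carrier (free_space K S) =
     {f \<in> UNIV \<rightarrow> carrier K. finite {s. f s \<noteq> \<zero>\<^bsub>K\<^esub>} \<and> {s. f s \<noteq> \<zero>\<^bsub>K\<^esub>} \<subseteq> S}"
  "zero (free_space K S) = (\<lambda>_. \<zero>\<^bsub>K\<^esub>)"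
  "add (free_space K S) = (\<lambda>f g s. f s \<oplus>\<^bsub>K\<^esub> g s)"
  "smult (free_space K S) = (\<lambda>c f s. c \<otimes>\<^bsub>K\<^esub> f s)"
  by (simp_all add: free_space_def)

lemma vectorspace_free_space:
  assumes "field K"
  shows "vectorspace K (free_space K S)"
proof -
  interpret field K by fact
  have add: "(\<lambda>s. f s \<oplus>\<^bsub>K\<^esub> g s) \<in> carrier (free_space K S)"
    if "f \<in> carrier (free_space K S)" "g \<in> carrier (free_space K S)" for f g
  proof -
    have "{s. f s \<oplus>\<^bsub>K\<^esub> g s \<noteq> \<zero>\<^bsub>K\<^esub>} \<subseteq> {s. f s \<noteq> \<zero>\<^bsub>K\<^esub>} \<union> {s. g s \<noteq> \<zero>\<^bsub>K\<^esub>}"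
      by auto
    with that show ?thesis
      by (auto intro: finite_subset[of _ "{s. f s \<noteq> \<zero>\<^bsub>K\<^esub>} \<union> {s. g s \<noteq> \<zero>\<^bsub>K\<^esub>}"])
  qed
  have smult: "(\<lambda>s. c \<otimes>\<^bsub>K\<^esub> f s) \<in> carrier (free_space K S)"
    if "c \<in> carrier K" "f \<in> carrier (free_space K S)" for c f
  proof -
    have "{s. c \<otimes>\<^bsub>K\<^esub> f s \<noteq> \<zero>\<^bsub>K\<^esub>} \<subseteq> {s. f s \<noteq> \<zero>\<^bsub>K\<^esub>}"
      using that by auto
    with that show ?thesis
      by (auto intro: finite_subset[of _ "{s. f s \<noteq> \<zero>\<^bsub>K\<^esub>}"])
  qed
  show ?thesis
  proof (rule vs_criteria)
    show "field K" ..
    show "\<forall>f\<in>carrier (free_space K S). \<exists>g\<in>carrier (free_space K S).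
        f \<oplus>\<^bsub>free_space K S\<^esub> g = \<zero>\<^bsub>free_space K S\<^esub>"
    proof
      fix f assume f: "f \<in> carrier (free_space K S)"
      show "\<exists>g\<in>carrier (free_space K S). f \<oplus>\<^bsub>free_space K S\<^esub> g = \<zero>\<^bsub>free_space K S\<^esub>"
      proof
        have "f s \<in> carrier K" for s using f by auto
        then show "f \<oplus>\<^bsub>free_space K S\<^esub> (\<lambda>s. (\<ominus>\<^bsub>K\<^esub> \<one>\<^bsub>K\<^esub>) \<otimes>\<^bsub>K\<^esub> f s) = \<zero>\<^bsub>free_space K S\<^esub>"
          by (simp add: l_minus r_neg)
      qed (use f in \<open>rule smult[OF a_inv_closed[OF one_closed]]\<close>)
    qed
    show "\<zero>\<^bsub>free_space K S\<^esub> \<in> carrier (free_space K S)" by auto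
    show "\<forall>v w. v \<in> carrier (free_space K S) \<and> w \<in> carrier (free_space K S) \<longrightarrow>
        v \<oplus>\<^bsub>free_space K S\<^esub> w \<in> carrier (free_space K S)"
      using add by simp
    show "\<forall>c v. c \<in> carrier K \<and> v \<in> carrier (free_space K S) \<longrightarrow>
        c \<odot>\<^bsub>free_space K S\<^esub> v \<in> carrier (free_space K S)"
      using smult by simp
  qed (auto simp: fun_eq_iff Pi_iff a_ac m_ac l_distr r_distr)
qed

lemma generator_closed:
  assumes "field K" and "s \<in> S"
  shows "generator K s \<in> carrier (free_space K S)"
proof -
  interpret field K by fact
  have "{t. generator K s t \<noteq> \<zero>\<^bsub>K\<^esub>} \<subseteq> {s}"
    by (auto simp: generator_def)
  then show ?thesis
    using assms by (auto simp: generator_def intro: finite_subset)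
qed

lemma free_space_induct [consumes 2, case_names zero add smult generator]:
  assumes "field K" and f: "f \<in> carrier (free_space K S)"
    and zero: "P \<zero>\<^bsub>free_space K S\<^esub>"
    and add: "\<And>f g. \<lbrakk>f \<in> carrier (free_space K S); g \<in> carrier (free_space K S); P f; P g\<rbrakk>
      \<Longrightarrow> P (f \<oplus>\<^bsub>free_space K S\<^esub> g)"
    and smult: "\<And>c f. \<lbrakk>c \<in> carrier K; f \<in> carrier (free_space K S); P f\<rbrakk>
      \<Longrightarrow> P (c \<odot>\<^bsub>free_space K S\<^esub> f)"
    and generator: "\<And>s. s \<in> S \<Longrightarrow> P (generator K s)"
  shows "P f"
proof -
  interpret field K by fact
  interpret F: vectorspace K "free_space K S" by (rule vectorspace_free_space) fact
  \<comment> \<open>The induction runs over a finite set containing the support, not over the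
    support itself: erasing the value at \<open>a\<close> leaves a function supported in
    \<open>A\<close>, whether or not that value was zero.\<close>
  have "P g" if "finite A" "{s. g s \<noteq> \<zero>\<^bsub>K\<^esub>} \<subseteq> A" "A \<subseteq> S" "g \<in> UNIV \<rightarrow> carrier K" for A g
    using that
  proof (induction A arbitrary: g)
    case empty
    then have "g = (\<lambda>_. \<zero>\<^bsub>K\<^esub>)" by auto
    then show ?case using zero by simp
  next
    case (insert a A)
    let ?h = "g(a := \<zero>\<^bsub>K\<^esub>)"
    have h: "{s. ?h s \<noteq> \<zero>\<^bsub>K\<^esub>} \<subseteq> A" "?h \<in> UNIV \<rightarrow> carrier K"
      using insert.prems by auto
    then have "?h \<in> carrier (free_space K S)"
      using insert.prems insert.hyps finite_subset[OF h(1)] by auto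
    moreover have "P ?h"
      using insert h by blast
    moreover have a: "generator K a \<in> carrier (free_space K S)" "g a \<in> carrier K"
      using insert.prems assms(1) by (auto intro: generator_closed simp del: free_space_simps)
    moreover have "P (g a \<odot>\<^bsub>free_space K S\<^esub> generator K a)"
      using insert.prems a by (auto intro!: smult generator simp del: free_space_simps)
    ultimately have "P (g a \<odot>\<^bsub>free_space K S\<^esub> generator K a \<oplus>\<^bsub>free_space K S\<^esub> ?h)"
      using F.smult_closed by (intro add)
    moreover have "g a \<odot>\<^bsub>free_space K S\<^esub> generator K a \<oplus>\<^bsub>free_space K S\<^esub> ?h = g"
      using insert.prems by (auto simp: generator_def fun_eq_iff Pi_iff)
    ultimately show ?case by metis
  qed
  then show ?thesis using f by auto
qed

section \<open>Bilinear maps and their linear extension to the free space\<close>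

locale bilinear_map = V: vectorspace K V + W: vectorspace K W + Z: vectorspace K Z
  for K (structure) and V and W and Z +
  fixes B
  assumes B_closed: "\<lbrakk>v \<in> carrier V; w \<in> carrier W\<rbrakk> \<Longrightarrow> B v w \<in> carrier Z"
    and B_add_left: "\<lbrakk>v \<in> carrier V; v' \<in> carrier V; w \<in> carrier W\<rbrakk>
      \<Longrightarrow> B (v \<oplus>\<^bsub>V\<^esub> v') w = B v w \<oplus>\<^bsub>Z\<^esub> B v' w"
    and B_add_right: "\<lbrakk>v \<in> carrier V; w \<in> carrier W; w' \<in> carrier W\<rbrakk>
      \<Longrightarrow> B v (w \<oplus>\<^bsub>W\<^esub> w') = B v w \<oplus>\<^bsub>Z\<^esub> B v w'"
    and B_smult_left: "\<lbrakk>c \<in> carrier K; v \<in> carrier V; w \<in> carrier W\<rbrakk>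
      \<Longrightarrow> B (c \<odot>\<^bsub>V\<^esub> v) w = c \<odot>\<^bsub>Z\<^esub> B v w"
    and B_smult_right: "\<lbrakk>c \<in> carrier K; v \<in> carrier V; w \<in> carrier W\<rbrakk>
      \<Longrightarrow> B v (c \<odot>\<^bsub>W\<^esub> w) = c \<odot>\<^bsub>Z\<^esub> B v w"
begin

abbreviation F where "F \<equiv> free_space K (carrier V \<times> carrier W)"

abbreviation \<delta> where "\<delta> \<equiv> generator K"

lemma field_K: "field K" ..

sublocale F: vectorspace K F
  by (rule vectorspace_free_space) (rule field_K)

declare free_space_simps [simp del]

text \<open>The linear extension of \<open>B\<close> from the generators. The sum runs over the
  support just as the action in \<open>tensor_module\<close> does, so that the two can later be
  compared term by term.\<close>

definition lift where
  "lift f = (\<Oplus>\<^bsub>Z\<^esub>p\<in>{p. f p \<noteq> \<zero>}. f p \<odot>\<^bsub>Z\<^esub> B (fst p) (snd p))"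

lemma F_coeff: "f \<in> carrier F \<Longrightarrow> f p \<in> carrier K"
  by (auto simp: free_space_simps)

lemma F_support: "f \<in> carrier F \<Longrightarrow> finite {p. f p \<noteq> \<zero>}"
  "f \<in> carrier F \<Longrightarrow> {p. f p \<noteq> \<zero>} \<subseteq> carrier V \<times> carrier W"
  by (auto simp: free_space_simps)

lemma B_zero_right: "v \<in> carrier V \<Longrightarrow> B v \<zero>\<^bsub>W\<^esub> = \<zero>\<^bsub>Z\<^esub>"
  using B_smult_right[of \<zero> v "\<zero>\<^bsub>W\<^esub>"] B_closed by simp

lemma B_finsum_right:
  assumes "finite A" and "g \<in> A \<rightarrow> carrier W" and "v \<in> carrier V"
  shows "B v (\<Oplus>\<^bsub>W\<^esub>w\<in>A. g w) = (\<Oplus>\<^bsub>Z\<^esub>w\<in>A. B v (g w))"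
  using assms
proof (induction A)
  case (insert a A)
  then have "(\<lambda>w. B v (g w)) \<in> A \<rightarrow> carrier Z" by (auto intro: B_closed)
  with insert show ?case
    by (simp add: Pi_iff B_closed B_add_right W.finsum_closed)
qed (simp add: B_zero_right)

text \<open>Sums and scalar multiples can have smaller supports than their ingredients; terms
  outside the support vanish, so a common index set may be used instead.\<close>

lemma lift_eq_finsum:
  assumes "f \<in> carrier F" and "finite S" and "{p. f p \<noteq> \<zero>} \<subseteq> S" and "S \<subseteq> carrier V \<times> carrier W"
  shows "lift f = (\<Oplus>\<^bsub>Z\<^esub>p\<in>S. f p \<odot>\<^bsub>Z\<^esub> B (fst p) (snd p))"
  unfolding lift_def
proof (rule Z.add.finprod_mono_neutral_cong_left)
  show "(\<lambda>p. f p \<odot>\<^bsub>Z\<^esub> B (fst p) (snd p)) \<in> S \<rightarrow> carrier Z"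
    using assms F_coeff by (auto intro!: Z.smult_closed B_closed)
  show "f p \<odot>\<^bsub>Z\<^esub> B (fst p) (snd p) = \<zero>\<^bsub>Z\<^esub>" if "p \<in> S - {p. f p \<noteq> \<zero>}" for p
  proof -
    have "B (fst p) (snd p) \<in> carrier Z"
      using that assms(4) by (intro B_closed) (auto simp: mem_Times_iff)
    then show ?thesis using that by simp
  qed
qed (use assms in auto)

lemma linear_map_lift: "linear_map K F Z lift"
proof -
  have closed: "lift f \<in> carrier Z" if "f \<in> carrier F" for f
    unfolding lift_def using F_support(2)[OF that] F_coeff[OF that]
    by (intro Z.finsum_closed) (auto intro!: Z.smult_closed B_closed)
  have add: "lift (f \<oplus>\<^bsub>F\<^esub> g) = lift f \<oplus>\<^bsub>Z\<^esub> lift g" if f: "f \<in> carrier F" and g: "g \<in> carrier F" for f g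
  proof -
    let ?S = "{p. f p \<noteq> \<zero>} \<union> {p. g p \<noteq> \<zero>}"
    have S: "finite ?S" "?S \<subseteq> carrier V \<times> carrier W"
      using F_support f g by auto
    then have B: "B (fst p) (snd p) \<in> carrier Z" if "p \<in> ?S" for p
      using that by (intro B_closed) auto
    have "lift (f \<oplus>\<^bsub>F\<^esub> g) = (\<Oplus>\<^bsub>Z\<^esub>p\<in>?S. (f p \<oplus> g p) \<odot>\<^bsub>Z\<^esub> B (fst p) (snd p))"
    proof -
      have "{p. (f \<oplus>\<^bsub>F\<^esub> g) p \<noteq> \<zero>} \<subseteq> ?S"
        by (auto simp: free_space_simps)
      from lift_eq_finsum[OF F.a_closed[OF f g] S(1) this S(2)] show ?thesis
        by (simp add: free_space_simps)
    qed
    also have "\<dots> = (\<Oplus>\<^bsub>Z\<^esub>p\<in>?S. f p \<odot>\<^bsub>Z\<^esub> B (fst p) (snd p) \<oplus>\<^bsub>Z\<^esub> g p \<odot>\<^bsub>Z\<^esub> B (fst p) (snd p))"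
      using f g B F_coeff by (intro Z.finsum_cong') (auto simp: Z.smult_l_distr)
    also have "\<dots> = (\<Oplus>\<^bsub>Z\<^esub>p\<in>?S. f p \<odot>\<^bsub>Z\<^esub> B (fst p) (snd p)) \<oplus>\<^bsub>Z\<^esub>
        (\<Oplus>\<^bsub>Z\<^esub>p\<in>?S. g p \<odot>\<^bsub>Z\<^esub> B (fst p) (snd p))"
      using f g B F_coeff by (intro Z.finsum_addf) auto
    also have "\<dots> = lift f \<oplus>\<^bsub>Z\<^esub> lift g"
      using lift_eq_finsum[OF f S(1) _ S(2)] lift_eq_finsum[OF g S(1) _ S(2)] by simp
    finally show ?thesis .
  qed
  have smult: "lift (c \<odot>\<^bsub>F\<^esub> f) = c \<odot>\<^bsub>Z\<^esub> lift f" if c: "c \<in> carrier K" and f: "f \<in> carrier F" for c f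
  proof -
    let ?S = "{p. f p \<noteq> \<zero>}"
    have B: "B (fst p) (snd p) \<in> carrier Z" if "p \<in> ?S" for p
      using that F_support[OF f] by (intro B_closed) auto
    have "lift (c \<odot>\<^bsub>F\<^esub> f) = (\<Oplus>\<^bsub>Z\<^esub>p\<in>?S. (c \<otimes> f p) \<odot>\<^bsub>Z\<^esub> B (fst p) (snd p))"
    proof -
      have "{p. (c \<odot>\<^bsub>F\<^esub> f) p \<noteq> \<zero>} \<subseteq> ?S"
        using c by (auto simp: free_space_simps)
      from lift_eq_finsum[OF F.smult_closed[OF c f] F_support(1)[OF f] this F_support(2)[OF f]]
      show ?thesis by (simp add: free_space_simps)
    qed
    also have "\<dots> = (\<Oplus>\<^bsub>Z\<^esub>p\<in>?S. c \<odot>\<^bsub>Z\<^esub> (f p \<odot>\<^bsub>Z\<^esub> B (fst p) (snd p)))"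
      using c f B F_coeff by (intro Z.finsum_cong') (auto simp: Z.smult_assoc1)
    also have "\<dots> = c \<odot>\<^bsub>Z\<^esub> lift f"
      unfolding lift_def using c f B F_coeff by (intro Z.finsum_smult[symmetric]) auto
    finally show ?thesis .
  qed
  show ?thesis
    using closed add smult
    by (auto simp: linear_map_def mod_hom_def mod_hom_axioms_def LinearCombinations.module_hom_def
        intro: F.vectorspace_axioms Z.vectorspace_axioms F.module_axioms Z.module_axioms)
qed

sublocale lift: linear_map K F Z lift
  by (rule linear_map_lift)

lemma \<delta>_closed: "\<lbrakk>v \<in> carrier V; w \<in> carrier W\<rbrakk> \<Longrightarrow> \<delta> (v, w) \<in> carrier F"
  by (rule generator_closed[OF field_K]) simp

lemma lift_\<delta>: "\<lbrakk>v \<in> carrier V; w \<in> carrier W\<rbrakk> \<Longrightarrow> lift (\<delta> (v, w)) = B v w"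
  using lift_eq_finsum[of "\<delta> (v, w)" "{(v, w)}"] \<delta>_closed[of v w] B_closed[of v w]
  by (auto simp: generator_def)

abbreviation N where "N \<equiv> tensor_kernel K V W"

text \<open>Each bilinearity law of \<open>B\<close> makes \<open>lift\<close> vanish on one of the
  four families of relations. The inclusion in the carrier is what the span lemmas for
  \<open>N\<close> require.\<close>

lemma bilinear_relations_subset:
  "bilinear_relations K V W \<subseteq> {g \<in> carrier F. lift g = \<zero>\<^bsub>Z\<^esub>}"
  unfolding bilinear_relations_def Let_def
  by (auto simp: \<delta>_closed lift_\<delta> B_closed B_add_left B_add_right B_smult_left B_smult_right)

lemma submodule_N: "submodule K N F"
  unfolding tensor_kernel_def using bilinear_relations_subset
  by (intro F.span_is_submodule) blast

lemma N_subset: "N \<subseteq> {g \<in> carrier F. lift g = \<zero>\<^bsub>Z\<^esub>}"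
  unfolding tensor_kernel_def
  using F.span_is_subset[OF bilinear_relations_subset] lift.ker_is_submodule
  by (simp add: lift.ker_def)

text \<open>Congruence modulo the relation space allows computing with representatives while the
  quotient is not yet known to be a vector space.\<close>

definition tensor_cong (infix \<open>\<approx>\<close> 50) where
  "f \<approx> g \<longleftrightarrow> f \<in> carrier F \<and> g \<in> carrier F \<and> f \<ominus>\<^bsub>F\<^esub> g \<in> N"

lemma tensor_cong_refl: "f \<in> carrier F \<Longrightarrow> f \<approx> f"
  using submodule.zero_closed[OF submodule_N] by (simp add: tensor_cong_def a_minus_def F.r_neg)

lemma tensor_cong_trans [trans]:
  assumes "f \<approx> g" "g \<approx> h"
  shows "f \<approx> h"
proof -
  have "f \<ominus>\<^bsub>F\<^esub> h = (f \<ominus>\<^bsub>F\<^esub> g) \<oplus>\<^bsub>F\<^esub> (g \<ominus>\<^bsub>F\<^esub> h)"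
    using assms by (simp add: tensor_cong_def a_minus_def F.a_assoc F.r_neg1)
  then show ?thesis
    using assms submodule.m_closed[OF submodule_N] by (simp add: tensor_cong_def)
qed

lemma tensor_cong_sym:
  assumes "f \<approx> g"
  shows "g \<approx> f"
proof -
  have "g \<ominus>\<^bsub>F\<^esub> f = (\<ominus> \<one>) \<odot>\<^bsub>F\<^esub> (f \<ominus>\<^bsub>F\<^esub> g)"
    using assms
    by (simp add: tensor_cong_def F.smult_minus_1 a_minus_def F.minus_add F.a_comm)
  then show ?thesis
    using assms submodule.smult_closed[OF submodule_N] by (simp add: tensor_cong_def)
qed

lemma tensor_cong_add:
  assumes "f \<approx> g" "f' \<approx> g'"
  shows "f \<oplus>\<^bsub>F\<^esub> f' \<approx> g \<oplus>\<^bsub>F\<^esub> g'"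
proof -
  have "(f \<oplus>\<^bsub>F\<^esub> f') \<ominus>\<^bsub>F\<^esub> (g \<oplus>\<^bsub>F\<^esub> g') = (f \<ominus>\<^bsub>F\<^esub> g) \<oplus>\<^bsub>F\<^esub> (f' \<ominus>\<^bsub>F\<^esub> g')"
    using assms by (simp add: tensor_cong_def a_minus_def F.minus_add F.a_ac)
  then show ?thesis
    using assms submodule.m_closed[OF submodule_N] by (simp add: tensor_cong_def)
qed

lemma tensor_cong_smult:
  assumes "f \<approx> g" "c \<in> carrier K"
  shows "c \<odot>\<^bsub>F\<^esub> f \<approx> c \<odot>\<^bsub>F\<^esub> g"
proof -
  have "c \<odot>\<^bsub>F\<^esub> f \<ominus>\<^bsub>F\<^esub> c \<odot>\<^bsub>F\<^esub> g = c \<odot>\<^bsub>F\<^esub> (f \<ominus>\<^bsub>F\<^esub> g)"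
    using assms by (simp add: tensor_cong_def a_minus_def F.smult_r_distr F.smult_r_minus)
  then show ?thesis
    using assms submodule.smult_closed[OF submodule_N] by (simp add: tensor_cong_def)
qed

lemma tensor_cong_finsum:
  assumes "finite A" and "\<And>a. a \<in> A \<Longrightarrow> f a \<approx> g a"
  shows "(\<Oplus>\<^bsub>F\<^esub>a\<in>A. f a) \<approx> (\<Oplus>\<^bsub>F\<^esub>a\<in>A. g a)"
  using assms
proof (induction A)
  case (insert a A)
  then have "f \<in> A \<rightarrow> carrier F" "g \<in> A \<rightarrow> carrier F" "f a \<in> carrier F" "g a \<in> carrier F"
    by (auto simp: tensor_cong_def)
  with insert show ?case by (simp add: tensor_cong_add)
qed (simp add: tensor_cong_refl)

lemma relation_cong:
  "\<lbrakk>v \<in> carrier V; v' \<in> carrier V; w \<in> carrier W\<rbrakk> \<Longrightarrow> \<delta> (v \<oplus>\<^bsub>V\<^esub> v', w) \<approx> \<delta> (v, w) \<oplus>\<^bsub>F\<^esub> \<delta> (v', w)"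
  "\<lbrakk>v \<in> carrier V; w \<in> carrier W; w' \<in> carrier W\<rbrakk> \<Longrightarrow> \<delta> (v, w \<oplus>\<^bsub>W\<^esub> w') \<approx> \<delta> (v, w) \<oplus>\<^bsub>F\<^esub> \<delta> (v, w')"
  "\<lbrakk>c \<in> carrier K; v \<in> carrier V; w \<in> carrier W\<rbrakk> \<Longrightarrow> \<delta> (c \<odot>\<^bsub>V\<^esub> v, w) \<approx> c \<odot>\<^bsub>F\<^esub> \<delta> (v, w)"
  "\<lbrakk>c \<in> carrier K; v \<in> carrier V; w \<in> carrier W\<rbrakk> \<Longrightarrow> \<delta> (v, c \<odot>\<^bsub>W\<^esub> w) \<approx> c \<odot>\<^bsub>F\<^esub> \<delta> (v, w)"
proof -
  have "bilinear_relations K V W \<subseteq> N"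
    unfolding tensor_kernel_def using bilinear_relations_subset by (intro F.in_own_span) blast
  then have rel: "f \<approx> g" if "f \<in> carrier F" "g \<in> carrier F" "f \<ominus>\<^bsub>F\<^esub> g \<in> bilinear_relations K V W" for f g
    using that by (auto simp: tensor_cong_def)
  show "\<delta> (v \<oplus>\<^bsub>V\<^esub> v', w) \<approx> \<delta> (v, w) \<oplus>\<^bsub>F\<^esub> \<delta> (v', w)"
    if "v \<in> carrier V" "v' \<in> carrier V" "w \<in> carrier W" for v v' w
  proof (rule rel)
    show "\<delta> (v \<oplus>\<^bsub>V\<^esub> v', w) \<ominus>\<^bsub>F\<^esub> (\<delta> (v, w) \<oplus>\<^bsub>F\<^esub> \<delta> (v', w)) \<in> bilinear_relations K V W"
      unfolding bilinear_relations_def Let_def using that by blast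
  qed (use that in \<open>auto simp: \<delta>_closed\<close>)
  show "\<delta> (v, w \<oplus>\<^bsub>W\<^esub> w') \<approx> \<delta> (v, w) \<oplus>\<^bsub>F\<^esub> \<delta> (v, w')"
    if "v \<in> carrier V" "w \<in> carrier W" "w' \<in> carrier W" for v w w'
  proof (rule rel)
    show "\<delta> (v, w \<oplus>\<^bsub>W\<^esub> w') \<ominus>\<^bsub>F\<^esub> (\<delta> (v, w) \<oplus>\<^bsub>F\<^esub> \<delta> (v, w')) \<in> bilinear_relations K V W"
      unfolding bilinear_relations_def Let_def using that by blast
  qed (use that in \<open>auto simp: \<delta>_closed\<close>)
  show "\<delta> (c \<odot>\<^bsub>V\<^esub> v, w) \<approx> c \<odot>\<^bsub>F\<^esub> \<delta> (v, w)"
    if "c \<in> carrier K" "v \<in> carrier V" "w \<in> carrier W" for c v w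
  proof (rule rel)
    show "\<delta> (c \<odot>\<^bsub>V\<^esub> v, w) \<ominus>\<^bsub>F\<^esub> c \<odot>\<^bsub>F\<^esub> \<delta> (v, w) \<in> bilinear_relations K V W"
      unfolding bilinear_relations_def Let_def using that by blast
  qed (use that in \<open>auto simp: \<delta>_closed\<close>)
  show "\<delta> (v, c \<odot>\<^bsub>W\<^esub> w) \<approx> c \<odot>\<^bsub>F\<^esub> \<delta> (v, w)"
    if "c \<in> carrier K" "v \<in> carrier V" "w \<in> carrier W" for c v w
  proof (rule rel)
    show "\<delta> (v, c \<odot>\<^bsub>W\<^esub> w) \<ominus>\<^bsub>F\<^esub> c \<odot>\<^bsub>F\<^esub> \<delta> (v, w) \<in> bilinear_relations K V W"
      unfolding bilinear_relations_def Let_def using that by blast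
  qed (use that in \<open>auto simp: \<delta>_closed\<close>)
qed

lemma \<delta>_zero_cong:
  "w \<in> carrier W \<Longrightarrow> \<delta> (\<zero>\<^bsub>V\<^esub>, w) \<approx> \<zero>\<^bsub>F\<^esub>"
  "v \<in> carrier V \<Longrightarrow> \<delta> (v, \<zero>\<^bsub>W\<^esub>) \<approx> \<zero>\<^bsub>F\<^esub>"
  using relation_cong(3)[of \<zero> "\<zero>\<^bsub>V\<^esub>" w] relation_cong(4)[of \<zero> v "\<zero>\<^bsub>W\<^esub>"]
  by (simp_all add: \<delta>_closed)

text \<open>Scalars cross the tensor sign: additivity on the right splits the sum, and homogeneity
  on both sides moves each coefficient to the left factor.\<close>

lemma \<delta>_finsum_cong:
  assumes "finite A" and "A \<subseteq> carrier W" and "k \<in> A \<rightarrow> carrier K" and "v \<in> carrier V"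
  shows "\<delta> (v, \<Oplus>\<^bsub>W\<^esub>w\<in>A. k w \<odot>\<^bsub>W\<^esub> w) \<approx> (\<Oplus>\<^bsub>F\<^esub>w\<in>A. \<delta> (k w \<odot>\<^bsub>V\<^esub> v, w))"
  using assms
proof (induction A)
  case (insert a A)
  have closed: "a \<in> carrier W" "k a \<in> carrier K" "(\<lambda>w. k w \<odot>\<^bsub>W\<^esub> w) \<in> A \<rightarrow> carrier W"
    "(\<lambda>w. \<delta> (k w \<odot>\<^bsub>V\<^esub> v, w)) \<in> A \<rightarrow> carrier F"
    using insert.prems by (auto intro!: \<delta>_closed W.smult_closed)
  have "\<delta> (v, k a \<odot>\<^bsub>W\<^esub> a \<oplus>\<^bsub>W\<^esub> (\<Oplus>\<^bsub>W\<^esub>w\<in>A. k w \<odot>\<^bsub>W\<^esub> w))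
      \<approx> \<delta> (v, k a \<odot>\<^bsub>W\<^esub> a) \<oplus>\<^bsub>F\<^esub> \<delta> (v, \<Oplus>\<^bsub>W\<^esub>w\<in>A. k w \<odot>\<^bsub>W\<^esub> w)"
    using closed insert.prems by (intro relation_cong) auto
  also have "\<dots> \<approx> \<delta> (k a \<odot>\<^bsub>V\<^esub> v, a) \<oplus>\<^bsub>F\<^esub> (\<Oplus>\<^bsub>F\<^esub>w\<in>A. \<delta> (k w \<odot>\<^bsub>V\<^esub> v, w))"
  proof (rule tensor_cong_add)
    \<comment> \<open>Both sides are congruent to \<open>k a\<close> times the generator at
      \<open>(v, a)\<close>.\<close>
    show "\<delta> (v, k a \<odot>\<^bsub>W\<^esub> a) \<approx> \<delta> (k a \<odot>\<^bsub>V\<^esub> v, a)"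
      using relation_cong(3,4)[of "k a" v a] closed insert.prems
      by (blast intro: tensor_cong_trans tensor_cong_sym)
    show "\<delta> (v, \<Oplus>\<^bsub>W\<^esub>w\<in>A. k w \<odot>\<^bsub>W\<^esub> w) \<approx> (\<Oplus>\<^bsub>F\<^esub>w\<in>A. \<delta> (k w \<odot>\<^bsub>V\<^esub> v, w))"
      using insert by auto
  qed
  finally show ?case
    using insert closed by (simp add: \<delta>_closed)
qed (simp add: \<delta>_zero_cong)

text \<open>Modulo the bilinearity relations every element is \<open>\<Sum>w\<in>A. c w \<otimes> w\<close>, where \<open>A\<close>
  generates \<open>W\<close>; the kernel of \<open>lift\<close> can therefore be tested on such sums.\<close>

lemma tensor_normal_form:
  assumes A: "finite A" "A \<subseteq> carrier W" "W.span A = carrier W" and f: "f \<in> carrier F"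
  shows "\<exists>c\<in>A \<rightarrow> carrier V. f \<approx> (\<Oplus>\<^bsub>F\<^esub>w\<in>A. \<delta> (c w, w))"
  using field_K f
proof (induction rule: free_space_induct)
  case zero
  have "(\<Oplus>\<^bsub>F\<^esub>w\<in>A. \<zero>\<^bsub>F\<^esub>) \<approx> (\<Oplus>\<^bsub>F\<^esub>w\<in>A. \<delta> (\<zero>\<^bsub>V\<^esub>, w))"
    using A by (intro tensor_cong_finsum tensor_cong_sym[OF \<delta>_zero_cong(1)]) auto
  then have "\<zero>\<^bsub>F\<^esub> \<approx> (\<Oplus>\<^bsub>F\<^esub>w\<in>A. \<delta> (\<zero>\<^bsub>V\<^esub>, w))"
    by simp
  then show ?case by (intro bexI[of _ "\<lambda>_. \<zero>\<^bsub>V\<^esub>"]) auto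
next
  case (add f g)
  then obtain c d where c: "c \<in> A \<rightarrow> carrier V" "f \<approx> (\<Oplus>\<^bsub>F\<^esub>w\<in>A. \<delta> (c w, w))"
    and d: "d \<in> A \<rightarrow> carrier V" "g \<approx> (\<Oplus>\<^bsub>F\<^esub>w\<in>A. \<delta> (d w, w))" by blast
  have "f \<oplus>\<^bsub>F\<^esub> g \<approx> (\<Oplus>\<^bsub>F\<^esub>w\<in>A. \<delta> (c w, w)) \<oplus>\<^bsub>F\<^esub> (\<Oplus>\<^bsub>F\<^esub>w\<in>A. \<delta> (d w, w))"
    using c d by (intro tensor_cong_add)
  also have "\<dots> = (\<Oplus>\<^bsub>F\<^esub>w\<in>A. \<delta> (c w, w) \<oplus>\<^bsub>F\<^esub> \<delta> (d w, w))"
    using c d A by (intro F.finsum_addf[symmetric]) (auto intro!: \<delta>_closed)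
  also have "\<dots> \<approx> (\<Oplus>\<^bsub>F\<^esub>w\<in>A. \<delta> (c w \<oplus>\<^bsub>V\<^esub> d w, w))"
    using c d A by (intro tensor_cong_finsum tensor_cong_sym[OF relation_cong(1)]) auto
  finally show ?case
    using c d by (intro bexI[of _ "\<lambda>w. c w \<oplus>\<^bsub>V\<^esub> d w"]) auto
next
  case (smult k f)
  then obtain c where c: "c \<in> A \<rightarrow> carrier V" "f \<approx> (\<Oplus>\<^bsub>F\<^esub>w\<in>A. \<delta> (c w, w))" by blast
  have "k \<odot>\<^bsub>F\<^esub> f \<approx> k \<odot>\<^bsub>F\<^esub> (\<Oplus>\<^bsub>F\<^esub>w\<in>A. \<delta> (c w, w))"
    using c smult by (intro tensor_cong_smult)
  also have "\<dots> = (\<Oplus>\<^bsub>F\<^esub>w\<in>A. k \<odot>\<^bsub>F\<^esub> \<delta> (c w, w))"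
    using c smult A by (intro F.finsum_smult) (auto intro!: \<delta>_closed)
  also have "\<dots> \<approx> (\<Oplus>\<^bsub>F\<^esub>w\<in>A. \<delta> (k \<odot>\<^bsub>V\<^esub> c w, w))"
    using c smult A by (intro tensor_cong_finsum tensor_cong_sym[OF relation_cong(3)]) auto
  finally show ?case
    using c smult by (intro bexI[of _ "\<lambda>w. k \<odot>\<^bsub>V\<^esub> c w"]) auto
next
  case (generator s)
  then obtain v w where s: "s = (v, w)" "v \<in> carrier V" "w \<in> carrier W" by auto
  then obtain k where "k \<in> A \<rightarrow> carrier K" "W.lincomb k A = w"
    using W.finite_in_span[of A w] A by auto
  then show ?case
    using \<delta>_finsum_cong[of A k v] A s
    by (intro bexI[of _ "\<lambda>w. k w \<odot>\<^bsub>V\<^esub> v"]) (auto simp: W.lincomb_def)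
qed

lemma lift_finsum_\<delta>:
  assumes "finite A" and "A \<subseteq> carrier W" and "c \<in> A \<rightarrow> carrier V"
  shows "lift (\<Oplus>\<^bsub>F\<^esub>w\<in>A. \<delta> (c w, w)) = (\<Oplus>\<^bsub>Z\<^esub>w\<in>A. B (c w) w)"
  using assms
proof (induction A)
  case (insert a A)
  then have "(\<lambda>w. \<delta> (c w, w)) \<in> A \<rightarrow> carrier F" "(\<lambda>w. B (c w) w) \<in> A \<rightarrow> carrier Z"
    by (auto intro!: \<delta>_closed B_closed)
  with insert show ?case by (simp add: \<delta>_closed B_closed lift_\<delta>)
qed simp

text \<open>An element killed by \<open>lift\<close> has a normal form over \<open>A\<close> that is
  killed too. By \<open>indep\<close> all left factors of the normal form are zero, so the element
  is congruent to zero, that is, it lies in \<open>N\<close>.\<close>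

lemma tensor_kernel_eq_ker:
  assumes A: "finite A" "A \<subseteq> carrier W" "W.span A = carrier W"
    and indep: "\<And>c. \<lbrakk>c \<in> A \<rightarrow> carrier V; (\<Oplus>\<^bsub>Z\<^esub>w\<in>A. B (c w) w) = \<zero>\<^bsub>Z\<^esub>\<rbrakk> \<Longrightarrow> \<forall>w\<in>A. c w = \<zero>\<^bsub>V\<^esub>"
  shows "N = {g \<in> carrier F. lift g = \<zero>\<^bsub>Z\<^esub>}"
proof
  show "{g \<in> carrier F. lift g = \<zero>\<^bsub>Z\<^esub>} \<subseteq> N"
  proof clarify
    fix g assume g: "g \<in> carrier F" "lift g = \<zero>\<^bsub>Z\<^esub>"
    then obtain c where c: "c \<in> A \<rightarrow> carrier V" and cong: "g \<approx> (\<Oplus>\<^bsub>F\<^esub>w\<in>A. \<delta> (c w, w))"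
      using tensor_normal_form[OF A] by blast
    then have "lift (g \<ominus>\<^bsub>F\<^esub> (\<Oplus>\<^bsub>F\<^esub>w\<in>A. \<delta> (c w, w))) = \<zero>\<^bsub>Z\<^esub>"
      using N_subset by (auto simp: tensor_cong_def)
    then have "\<zero>\<^bsub>Z\<^esub> = lift (\<Oplus>\<^bsub>F\<^esub>w\<in>A. \<delta> (c w, w))"
      using g cong by (simp add: tensor_cong_def)
    also have "\<dots> = (\<Oplus>\<^bsub>Z\<^esub>w\<in>A. B (c w) w)"
      using A c by (intro lift_finsum_\<delta>)
    finally have "\<forall>w\<in>A. c w = \<zero>\<^bsub>V\<^esub>"
      using indep c by simp
    then have "(\<Oplus>\<^bsub>F\<^esub>w\<in>A. \<delta> (c w, w)) \<approx> (\<Oplus>\<^bsub>F\<^esub>w\<in>A. \<zero>\<^bsub>F\<^esub>)"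
      using A \<delta>_zero_cong by (intro tensor_cong_finsum) auto
    with cong have "g \<approx> \<zero>\<^bsub>F\<^esub>"
      by (auto intro: tensor_cong_trans)
    then show "g \<in> N"
      using g F.minus_add_cancel(1)[of g "\<zero>\<^bsub>F\<^esub>"] by (simp add: tensor_cong_def)
  qed
qed (rule N_subset)

end

section \<open>A criterion for a module to be isomorphic to the tensor module\<close>

lemma (in mod_hom) hom_finsum:
  assumes "g \<in> A \<rightarrow> carrier M"
  shows "f (\<Oplus>\<^bsub>M\<^esub>a\<in>A. g a) = (\<Oplus>\<^bsub>N\<^esub>a\<in>A. f (g a))"
  using assms
proof (induction A rule: infinite_finite_induct)
  case (insert a A)
  then have "(\<lambda>a. f (g a)) \<in> A \<rightarrow> carrier N" by auto
  with insert show ?case by (simp add: Pi_iff M.finsum_closed)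
qed simp_all

lemma (in lie_module) act_finsum:
  assumes "x \<in> carrier L" and "g \<in> A \<rightarrow> carrier V"
  shows "(\<Oplus>\<^bsub>V\<^esub>a\<in>A. g a) \<triangleleft>\<^bsub>V\<^esub> x = (\<Oplus>\<^bsub>V\<^esub>a\<in>A. g a \<triangleleft>\<^bsub>V\<^esub> x)"
proof -
  have "mod_hom K V V (\<lambda>v. v \<triangleleft>\<^bsub>V\<^esub> x)"
    using assms(1)
    by unfold_locales (auto simp: LinearCombinations.module_hom_def act_closed act_add_left act_smult_left)
  then show ?thesis using assms(2) by (rule mod_hom.hom_finsum)
qed

text \<open>Two decompositions of one element give \<open>x' - x = y - y'\<close>, which lies in
  both subgroups and so vanishes. Hence the description operator in \<open>summand\<close> is well
  defined.\<close>

lemma (in abelian_group) summand_add: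
  assumes I: "additive_subgroup I G" and J: "additive_subgroup J G" and int: "I \<inter> J = {\<zero>}"
    and x: "x \<in> I" and y: "y \<in> J"
  shows "summand G I J (x \<oplus> y) = x"
  unfolding summand_def
proof (rule the_equality)
  fix x' assume "x' \<in> I \<and> (\<exists>z\<in>J. x \<oplus> y = x' \<oplus> z)"
  then obtain y' where *: "x' \<in> I" "y' \<in> J" "x \<oplus> y = x' \<oplus> y'" by blast
  have closed: "x \<in> carrier G" "y \<in> carrier G" "x' \<in> carrier G" "y' \<in> carrier G"
    using * x y additive_subgroup.a_subset[OF I] additive_subgroup.a_subset[OF J] by auto
  have "x' \<ominus> x \<oplus> (x \<oplus> y') = x' \<oplus> y'"
    using closed by (simp add: minus_add_cancel flip: a_assoc)
  also have "\<dots> = y \<oplus> x"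
    using closed by (simp add: a_comm flip: *(3))
  also have "\<dots> = y \<ominus> y' \<oplus> (y' \<oplus> x)"
    using closed by (simp add: minus_add_cancel flip: a_assoc)
  finally have "x' \<ominus> x \<oplus> (x \<oplus> y') = y \<ominus> y' \<oplus> (x \<oplus> y')"
    using closed by (simp add: a_comm[of y' x])
  then have eq: "x' \<ominus> x = y \<ominus> y'"
    using closed by (simp add: add.right_cancel)
  have "x' \<ominus> x \<in> I"
    using * x I by (simp add: a_minus_def additive_subgroup.a_closed
        additive_subgroup.a_inv_closed abelian_group_axioms)
  moreover have "x' \<ominus> x \<in> J"
    unfolding eq using * y J by (simp add: a_minus_def additive_subgroup.a_closed
        additive_subgroup.a_inv_closed abelian_group_axioms)
  ultimately have "x' \<ominus> x = \<zero>" using int by blast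
  then show "x' = x" using closed minus_add_cancel(1)[of x' x] by simp
qed (use x y in auto)

lemma submodule_additive_subgroup:
  assumes "submodule K N M"
  shows "additive_subgroup N M"
proof -
  interpret Module.module K M using assms by (simp add: submodule_def)
  show ?thesis
  proof (intro additive_subgroup.intro add.subgroupI)
    show "\<ominus>\<^bsub>M\<^esub> a \<in> N" if "a \<in> N" for a
      using submodule.smult_closed[OF assms R.a_inv_closed[OF R.one_closed] that]
        submodule.subset[OF assms] that
      by (auto simp: smult_minus_1)
  qed (use submodule.subset[OF assms] submodule.zero_closed[OF assms] submodule.m_closed[OF assms] in auto)
qed

text \<open>\<open>indep\<close> identifies the kernel of the extension of \<open>B\<close> with the
  relation space, and \<open>spanning\<close> makes the extension onto, so \<open>V\<close> is in
  bijection with the tensor space. Equivariance of \<open>B\<close> in each argument matches the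
  actions. That the tensor module satisfies the module axioms is part of the conclusion, since these
  axioms are transported from \<open>V\<close>.\<close>

lemma tensor_module_isomorphic:
  assumes sum: "lie_direct_sum K L I\<^sub>1 I\<^sub>2" and "lie_module K L V"
    and "bilinear_map K V\<^sub>1 V\<^sub>2 V B"
    and act1: "\<And>v x. \<lbrakk>v \<in> carrier V\<^sub>1; x \<in> I\<^sub>1\<rbrakk> \<Longrightarrow> v \<triangleleft>\<^bsub>V\<^sub>1\<^esub> x \<in> carrier V\<^sub>1"
    and act2: "\<And>w y. \<lbrakk>w \<in> carrier V\<^sub>2; y \<in> I\<^sub>2\<rbrakk> \<Longrightarrow> w \<triangleleft>\<^bsub>V\<^sub>2\<^esub> y \<in> carrier V\<^sub>2"
    and equiv1: "\<And>v w x. \<lbrakk>v \<in> carrier V\<^sub>1; w \<in> carrier V\<^sub>2; x \<in> I\<^sub>1\<rbrakk>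
      \<Longrightarrow> B (v \<triangleleft>\<^bsub>V\<^sub>1\<^esub> x) w = B v w \<triangleleft>\<^bsub>V\<^esub> x"
    and equiv2: "\<And>v w y. \<lbrakk>v \<in> carrier V\<^sub>1; w \<in> carrier V\<^sub>2; y \<in> I\<^sub>2\<rbrakk>
      \<Longrightarrow> B v (w \<triangleleft>\<^bsub>V\<^sub>2\<^esub> y) = B v w \<triangleleft>\<^bsub>V\<^esub> y"
    and A: "finite A" "A \<subseteq> carrier V\<^sub>2" "LinearCombinations.module.span K V\<^sub>2 A = carrier V\<^sub>2"
    and indep: "\<And>c. \<lbrakk>c \<in> A \<rightarrow> carrier V\<^sub>1; (\<Oplus>\<^bsub>V\<^esub>w\<in>A. B (c w) w) = \<zero>\<^bsub>V\<^esub>\<rbrakk>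
      \<Longrightarrow> \<forall>w\<in>A. c w = \<zero>\<^bsub>V\<^sub>1\<^esub>"
    and spanning: "\<And>z. z \<in> carrier V \<Longrightarrow> \<exists>c\<in>A \<rightarrow> carrier V\<^sub>1. z = (\<Oplus>\<^bsub>V\<^esub>w\<in>A. B (c w) w)"
  shows "lie_module_isomorphic K L V (tensor_module K L I\<^sub>1 I\<^sub>2 V\<^sub>1 V\<^sub>2)"
proof -
  interpret L: lie_direct_sum K L I\<^sub>1 I\<^sub>2 by fact
  interpret V: lie_module K L V by fact
  interpret B: bilinear_map K V\<^sub>1 V\<^sub>2 V B by fact
  let ?T = "tensor_space K V\<^sub>1 V\<^sub>2" and ?pt = "pure_tensor K V\<^sub>1 V\<^sub>2"
  have N: "tensor_kernel K V\<^sub>1 V\<^sub>2 = {g \<in> carrier B.F. B.lift g = \<zero>\<^bsub>V\<^esub>}"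
    using A indep by (rule B.tensor_kernel_eq_ker)
  have surj: "B.lift ` carrier B.F = carrier V"
  proof
    show "carrier V \<subseteq> B.lift ` carrier B.F"
    proof
      fix z assume "z \<in> carrier V"
      then obtain c where c: "c \<in> A \<rightarrow> carrier V\<^sub>1" "z = (\<Oplus>\<^bsub>V\<^esub>w\<in>A. B (c w) w)"
        using spanning by blast
      have "(\<Oplus>\<^bsub>B.F\<^esub>w\<in>A. B.\<delta> (c w, w)) \<in> carrier B.F"
        using A c by (intro B.F.finsum_closed) (auto intro!: B.\<delta>_closed)
      then show "z \<in> B.lift ` carrier B.F"
        using B.lift_finsum_\<delta>[OF A(1,2) c(1)] c(2) by force
    qed
  qed auto
  define q where "q z = {g \<in> carrier B.F. B.lift g = z}" for z
  note fibers = quotient_space_fibers[OF B.linear_map_lift surj N, folded q_def tensor_space_def]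
  have pt: "?pt v w = q (B v w)" if "v \<in> carrier V\<^sub>1" "w \<in> carrier V\<^sub>2" for v w
    using that by (simp add: pure_tensor_def fibers(1) B.\<delta>_closed B.lift_\<delta>)
  have linear_q: "linear_map K V ?T q"
    using V.vectorspace_axioms fibers(2-5) by (rule linear_map_transport)
  interpret T: vectorspace K ?T
    using linear_q by (simp add: linear_map_def)
  interpret q: linear_map K V ?T q
    by (rule linear_q)
  have act: "q (z \<triangleleft>\<^bsub>V\<^esub> x) = q z \<triangleleft>\<^bsub>tensor_module K L I\<^sub>1 I\<^sub>2 V\<^sub>1 V\<^sub>2\<^esub> x"
    if z: "z \<in> carrier V" and x: "x \<in> carrier L" for z x
  proof -
    from x obtain x\<^sub>1 x\<^sub>2 where x12: "x\<^sub>1 \<in> I\<^sub>1" "x\<^sub>2 \<in> I\<^sub>2" "x = x\<^sub>1 \<oplus>\<^bsub>L\<^esub> x\<^sub>2"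
      unfolding L.sum_eq[symmetric] set_add_def' by blast
    have I: "additive_subgroup I\<^sub>1 L" "additive_subgroup I\<^sub>2 L"
      using L.ideal1 L.ideal2 by (auto simp: lie_ideal_def subspace_def submodule_additive_subgroup)
    have xL: "x\<^sub>1 \<in> carrier L" "x\<^sub>2 \<in> carrier L"
      using x12 I by (auto dest: additive_subgroup.a_subset)
    have s1: "summand L I\<^sub>1 I\<^sub>2 x = x\<^sub>1"
      unfolding x12(3) using I L.int_zero x12(1,2) by (rule L.summand_add)
    \<comment> \<open>The second component is \<open>summand\<close> with the ideals exchanged, so
      the sum has to be turned round before \<open>summand_add\<close> applies.\<close>
    have "x = x\<^sub>2 \<oplus>\<^bsub>L\<^esub> x\<^sub>1"
      using x12 xL by (simp add: L.M.a_comm)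
    moreover have "summand L I\<^sub>2 I\<^sub>1 (x\<^sub>2 \<oplus>\<^bsub>L\<^esub> x\<^sub>1) = x\<^sub>2"
      using I(2,1) L.int_zero x12(2,1) by (intro L.summand_add) auto
    ultimately have s2: "summand L I\<^sub>2 I\<^sub>1 x = x\<^sub>2" by simp
    \<comment> \<open>Every representative \<open>f\<close> of the tensor yields the same value, so
      the union in \<open>tensor_module\<close> collapses. Term by term, acting with the first
      component on the left factor plus the second on the right factor is acting with
      \<open>x\<close> on the value of \<open>B\<close>; linearity then reassembles
      \<open>lift f\<close>.\<close>
    have "(\<Oplus>\<^bsub>?T\<^esub>p\<in>{p. f p \<noteq> \<zero>\<^bsub>K\<^esub>}. f p \<odot>\<^bsub>?T\<^esub> (?pt (fst p \<triangleleft>\<^bsub>V\<^sub>1\<^esub> x\<^sub>1) (snd p)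
        \<oplus>\<^bsub>?T\<^esub> ?pt (fst p) (snd p \<triangleleft>\<^bsub>V\<^sub>2\<^esub> x\<^sub>2))) = q (z \<triangleleft>\<^bsub>V\<^esub> x)" if f: "f \<in> q z" for f
    proof -
      let ?S = "{p. f p \<noteq> \<zero>\<^bsub>K\<^esub>}"
      have fF: "f \<in> carrier B.F" "B.lift f = z" using f by (auto simp: q_def)
      have S: "fst p \<in> carrier V\<^sub>1" "snd p \<in> carrier V\<^sub>2" if "p \<in> ?S" for p
        using B.F_support(2)[OF fF(1)] that by (auto simp: mem_Times_iff)
      have summand: "f p \<odot>\<^bsub>?T\<^esub> (?pt (fst p \<triangleleft>\<^bsub>V\<^sub>1\<^esub> x\<^sub>1) (snd p)
          \<oplus>\<^bsub>?T\<^esub> ?pt (fst p) (snd p \<triangleleft>\<^bsub>V\<^sub>2\<^esub> x\<^sub>2)) = q ((f p \<odot>\<^bsub>V\<^esub> B (fst p) (snd p)) \<triangleleft>\<^bsub>V\<^esub> x)"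
        if "p \<in> ?S" for p
        using S[OF that] x12 xL B.F_coeff[OF fF(1)]
        by (simp add: pt act1 act2 equiv1 equiv2 B.B_closed V.act_closed V.act_add_right
            V.act_smult_left T.smult_r_distr)
      have closed: "(\<lambda>p. (f p \<odot>\<^bsub>V\<^esub> B (fst p) (snd p)) \<triangleleft>\<^bsub>V\<^esub> x) \<in> ?S \<rightarrow> carrier V"
        "(\<lambda>p. f p \<odot>\<^bsub>V\<^esub> B (fst p) (snd p)) \<in> ?S \<rightarrow> carrier V"
        using S x B.F_coeff[OF fF(1)] by (auto simp: B.B_closed intro!: V.act_closed)
      have fin: "finite ?S" using fF by (intro B.F_support)
      have "(\<Oplus>\<^bsub>?T\<^esub>p\<in>?S. f p \<odot>\<^bsub>?T\<^esub> (?pt (fst p \<triangleleft>\<^bsub>V\<^sub>1\<^esub> x\<^sub>1) (snd p)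
          \<oplus>\<^bsub>?T\<^esub> ?pt (fst p) (snd p \<triangleleft>\<^bsub>V\<^sub>2\<^esub> x\<^sub>2)))
        = (\<Oplus>\<^bsub>?T\<^esub>p\<in>?S. q ((f p \<odot>\<^bsub>V\<^esub> B (fst p) (snd p)) \<triangleleft>\<^bsub>V\<^esub> x))"
        using summand closed by (intro T.finsum_cong') auto
      also have "\<dots> = q (\<Oplus>\<^bsub>V\<^esub>p\<in>?S. (f p \<odot>\<^bsub>V\<^esub> B (fst p) (snd p)) \<triangleleft>\<^bsub>V\<^esub> x)"
        using closed(1) by (rule q.hom_finsum[symmetric])
      also have "(\<Oplus>\<^bsub>V\<^esub>p\<in>?S. (f p \<odot>\<^bsub>V\<^esub> B (fst p) (snd p)) \<triangleleft>\<^bsub>V\<^esub> x) = B.lift f \<triangleleft>\<^bsub>V\<^esub> x"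
        unfolding B.lift_def using x closed(2) by (rule V.act_finsum[symmetric])
      finally show ?thesis by (simp add: fF)
    qed
    moreover have "q z \<noteq> {}"
    proof -
      from z obtain g where "g \<in> carrier B.F" "z = B.lift g"
        unfolding surj[symmetric] by blast
      then show ?thesis by (auto simp: q_def)
    qed
    ultimately show ?thesis
      by (auto simp: tensor_module_def Let_def module.extend_def lie_module.fields_def s1 s2)
  qed
  have "lie_module_iso K L V (tensor_module K L I\<^sub>1 I\<^sub>2 V\<^sub>1 V\<^sub>2) q"
    using V.lie_module_axioms fibers(2-5) act
    by (intro lie_module_iso_transport)
      (simp_all add: tensor_module_def Let_def module.extend_def lie_module.fields_def)
  then show ?thesis
    unfolding lie_module_isomorphic_def by blast
qed

section \<open>Irreducible modules of commuting actions\<close>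

context vectorspace
begin

lemma subspaceI:
  assumes "X \<subseteq> carrier V" and "\<zero>\<^bsub>V\<^esub> \<in> X"
    and "\<And>v w. \<lbrakk>v \<in> X; w \<in> X\<rbrakk> \<Longrightarrow> v \<oplus>\<^bsub>V\<^esub> w \<in> X"
    and "\<And>c v. \<lbrakk>c \<in> carrier K; v \<in> X\<rbrakk> \<Longrightarrow> c \<odot>\<^bsub>V\<^esub> v \<in> X"
  shows "subspace K X V"
  using assms vectorspace_axioms module_axioms by (simp add: subspace_def submodule_def)

lemma subspaceD:
  assumes "subspace K X V"
  shows "X \<subseteq> carrier V" and "\<zero>\<^bsub>V\<^esub> \<in> X"
    and "\<And>v w. \<lbrakk>v \<in> X; w \<in> X\<rbrakk> \<Longrightarrow> v \<oplus>\<^bsub>V\<^esub> w \<in> X"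
    and "\<And>c v. \<lbrakk>c \<in> carrier K; v \<in> X\<rbrakk> \<Longrightarrow> c \<odot>\<^bsub>V\<^esub> v \<in> X"
  using assms by (auto simp: subspace_def submodule_def)

lemma subspace_finsum:
  assumes "subspace K X V" and "g \<in> A \<rightarrow> X"
  shows "(\<Oplus>\<^bsub>V\<^esub>a\<in>A. g a) \<in> X"
  using assms(2)
proof (induction A rule: infinite_finite_induct)
  case (insert a A)
  then have "g \<in> A \<rightarrow> carrier V" "g a \<in> carrier V" "g a \<in> X"
    using subspaceD(1)[OF assms(1)] by auto
  with insert show ?case
    using subspaceD(3)[OF assms(1)] by simp
qed (use subspaceD(2)[OF assms(1)] in simp_all)

lemma subspace_of_vs:
  assumes "subspace K X (vs U)" and "subspace K U V"
  shows "subspace K X V" and "X \<subseteq> U"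
proof -
  show "X \<subseteq> U" using assms(1) by (auto simp: subspace_def submodule_def)
  then show "subspace K X V"
    using assms by (intro subspaceI) (auto simp: subspace_def submodule_def)
qed

text \<open>Independent subsets of \<open>X\<close> have at most \<open>dim\<close> elements, so a
  maximal one exists, and maximality makes it generate \<open>X\<close>. Finite dimension of
  \<open>X\<close> is not presupposed; \<open>fin_dim_subspace\<close> draws it from here.\<close>

lemma subspace_basis:
  assumes "fin_dim" and X: "subspace K X V"
  obtains b where "finite b" "b \<subseteq> X" "lin_indpt b" "span b = X"
proof -
  interpret X: vectorspace K "vs X" by (rule subspace_is_vs) fact
  have sub: "submodule K X V" using X by simp
  have "\<exists>b. finite b \<and> maximal b (\<lambda>S. S \<subseteq> X \<and> lin_indpt S)"
  proof (rule maximal_exists[where N = dim])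
    show "{} \<subseteq> X \<and> lin_indpt {}" by (simp add: lin_dep_def)
  qed (use li_le_dim[OF assms(1)] subspaceD(1)[OF X] in auto)
  then obtain b where b: "finite b" "maximal b (\<lambda>S. S \<subseteq> X \<and> lin_indpt S)" by blast
  have "maximal b (\<lambda>S. S \<subseteq> carrier (vs X) \<and> X.lin_indpt S)"
    using b(2) span_li_not_depend(2)[OF _ sub] by (simp add: maximal_def cong: conj_cong)
  then have "X.span b = X"
    using X.max_li_is_gen by simp
  then have "span b = X"
    using b(2) span_li_not_depend(1)[OF _ sub] by (simp add: maximal_def)
  then show ?thesis using b that by (auto simp: maximal_def)
qed

lemma fin_dim_subspace:
  assumes "fin_dim" and X: "subspace K X V"
  shows "vectorspace.fin_dim K (vs X)"
proof -
  interpret X: vectorspace K "vs X" by (rule subspace_is_vs) fact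
  obtain b where "finite b" "b \<subseteq> X" "span b = X"
    using subspace_basis[OF assms] by metis
  then show ?thesis
    unfolding X.fin_dim_def using span_li_not_depend(1)[of b X] X by auto
qed

text \<open>A basis of \<open>X\<close> is an independent subset of \<open>Y\<close> with at least
  \<open>dim\<close> of \<open>Y\<close> elements, hence a basis of \<open>Y\<close> as
  well.\<close>

lemma subspace_dim_eq:
  assumes "fin_dim" and X: "subspace K X V" and Y: "subspace K Y V" and "X \<subseteq> Y"
    and dim: "vectorspace.dim K (vs Y) \<le> vectorspace.dim K (vs X)"
  shows "X = Y"
proof -
  interpret X: vectorspace K "vs X" by (rule subspace_is_vs) fact
  interpret Y: vectorspace K "vs Y" by (rule subspace_is_vs) fact
  obtain b where b: "finite b" "b \<subseteq> X" "lin_indpt b" "span b = X"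
    using subspace_basis[OF assms(1) X] by metis
  then have "X.basis b"
    using span_li_not_depend[of b X] X by (simp add: X.basis_def)
  then have "Y.dim \<le> card b"
    using X.dim_basis b(1) dim by simp
  moreover have "b \<subseteq> Y" using b \<open>X \<subseteq> Y\<close> by blast
  ultimately have "Y.basis b"
    using Y.dim_li_is_basis[OF fin_dim_subspace[OF assms(1) Y] b(1)] b(3)
      span_li_not_depend(2)[of b Y] Y by simp
  then have "span b = Y"
    using span_li_not_depend(1)[of b Y] Y \<open>b \<subseteq> Y\<close> by (simp add: Y.basis_def)
  then show ?thesis using b by simp
qed

text \<open>Negation in \<open>vs X\<close> is a description over the smaller carrier, so it does
  not agree with negation in \<open>V\<close> by definition; both are multiplication by the scalar
  -1.\<close>

lemma minus_subspace:
  assumes "subspace K X V" and "v \<in> X" and "w \<in> X"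
  shows "v \<ominus>\<^bsub>vs X\<^esub> w = v \<ominus>\<^bsub>V\<^esub> w"
proof -
  interpret X: vectorspace K "vs X" by (rule subspace_is_vs) fact
  have "\<ominus>\<^bsub>vs X\<^esub> w = \<ominus>\<^bsub>V\<^esub> w"
    using assms subspaceD(1)[OF assms(1)] X.smult_minus_1[of w] smult_minus_1[of w] by auto
  then show ?thesis by (simp add: a_minus_def)
qed

lemma eq_if_add_minus_one_smult_zero:
  assumes "v \<in> carrier V" "w \<in> carrier V" and "v \<oplus>\<^bsub>V\<^esub> (\<ominus>\<^bsub>K\<^esub> \<one>\<^bsub>K\<^esub>) \<odot>\<^bsub>V\<^esub> w = \<zero>\<^bsub>V\<^esub>"
  shows "v = w"
  using assms M.minus_other_side[of v w] by (simp add: smult_minus_1 a_minus_def)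

end

section \<open>Stable subspaces and intertwiners\<close>

context lie_module
begin

text \<open>Stability under a set \<open>I\<close> of acting elements, without passing to the Lie
  algebra on \<open>I\<close>: subspaces stable under different ideals are then compared inside one
  module record.\<close>

definition stable where
  "stable I X \<longleftrightarrow> subspace K X V \<and> (\<forall>v\<in>X. \<forall>x\<in>I. v \<triangleleft>\<^bsub>V\<^esub> x \<in> X)"

definition stable_irreducible where
  "stable_irreducible I U \<longleftrightarrow> stable I U \<and> U \<noteq> {\<zero>\<^bsub>V\<^esub>} \<and>
     (\<forall>X. stable I X \<longrightarrow> X \<subseteq> U \<longrightarrow> X = {\<zero>\<^bsub>V\<^esub>} \<or> X = U)"

text \<open>Only arguments in \<open>U\<close> are constrained. Different functions can therefore
  stand for the same homomorphism, and equality of intertwiners is always equality on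
  \<open>U\<close>.\<close>

definition intertwiner where
  "intertwiner I U f \<longleftrightarrow> f \<in> U \<rightarrow> carrier V \<and>
     (\<forall>u\<in>U. \<forall>v\<in>U. f (u \<oplus>\<^bsub>V\<^esub> v) = f u \<oplus>\<^bsub>V\<^esub> f v) \<and>
     (\<forall>c\<in>carrier K. \<forall>u\<in>U. f (c \<odot>\<^bsub>V\<^esub> u) = c \<odot>\<^bsub>V\<^esub> f u) \<and>
     (\<forall>u\<in>U. \<forall>x\<in>I. f (u \<triangleleft>\<^bsub>V\<^esub> x) = f u \<triangleleft>\<^bsub>V\<^esub> x)"

text \<open>A nonzero stable subspace of least dimension has no smaller nonzero stable subspace,
  because a subspace of no smaller dimension fills it. The whole of \<open>V\<close> shows that
  candidates exist.\<close>

lemma exists_stable_irreducible: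
  assumes "fin_dim" and "carrier V \<noteq> {\<zero>\<^bsub>V\<^esub>}" and "I \<subseteq> carrier L"
  obtains U where "stable_irreducible I U"
proof -
  let ?P = "\<lambda>X. stable I X \<and> X \<noteq> {\<zero>\<^bsub>V\<^esub>}"
  let ?d = "\<lambda>X. vectorspace.dim K (V\<lparr>carrier := X\<rparr>)"
  have "subspace K (carrier V) V" by (rule subspaceI) auto
  then have "?P (carrier V)"
    using assms act_closed by (auto simp: stable_def)
  then obtain U where U: "?P U" "\<And>X. ?P X \<Longrightarrow> ?d U \<le> ?d X"
    using ex_has_least_nat[of ?P "carrier V" ?d] by blast
  have "X = U" if "stable I X" "X \<subseteq> U" "X \<noteq> {\<zero>\<^bsub>V\<^esub>}" for X
    using that U subspace_dim_eq[OF assms(1), of X U] by (simp add: stable_def)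
  then have "stable_irreducible I U"
    using U(1) unfolding stable_irreducible_def by blast
  then show ?thesis by (rule that)
qed

text \<open>This is the kernel of \<open>f - g\<close>, stated as an equalizer so that no difference
  of intertwiners has to be formed.\<close>

lemma stable_equalizer:
  assumes "stable I U" and I: "I \<subseteq> carrier L" and f: "intertwiner I U f" and g: "intertwiner I U g"
  shows "stable I {u \<in> U. f u = g u}"
proof -
  have U: "subspace K U V" "\<And>u x. \<lbrakk>u \<in> U; x \<in> I\<rbrakk> \<Longrightarrow> u \<triangleleft>\<^bsub>V\<^esub> x \<in> U"
    using assms(1) by (auto simp: stable_def)
  note U' = subspaceD[OF U(1)]
  have zero: "h \<zero>\<^bsub>V\<^esub> = \<zero>\<^bsub>V\<^esub>" if "intertwiner I U h" for h
  proof -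
    have "h \<zero>\<^bsub>V\<^esub> \<in> carrier V" "h (\<zero>\<^bsub>K\<^esub> \<odot>\<^bsub>V\<^esub> \<zero>\<^bsub>V\<^esub>) = \<zero>\<^bsub>K\<^esub> \<odot>\<^bsub>V\<^esub> h \<zero>\<^bsub>V\<^esub>"
      using that U'(2) lie.R.zero_closed unfolding intertwiner_def by blast+
    then show ?thesis by simp
  qed
  have "subspace K {u \<in> U. f u = g u} V"
  proof (rule subspaceI)
    show "{u \<in> U. f u = g u} \<subseteq> carrier V" using U' by auto
    show "\<zero>\<^bsub>V\<^esub> \<in> {u \<in> U. f u = g u}" using U' zero[OF f] zero[OF g] by simp
  qed (use f g U' in \<open>auto simp: intertwiner_def\<close>)
  then show ?thesis
    using f g U by (auto simp: stable_def intertwiner_def)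
qed

text \<open>The equalizer is stable and contains \<open>u\<close>, which is nonzero, so by
  irreducibility it is all of \<open>U\<close>. Consequently evaluation at a nonzero vector is
  injective on homomorphisms.\<close>

lemma intertwiner_eqI:
  assumes "stable_irreducible I U" and "I \<subseteq> carrier L" and "intertwiner I U f" "intertwiner I U g"
    and "u \<in> U" "u \<noteq> \<zero>\<^bsub>V\<^esub>" "f u = g u" and "v \<in> U"
  shows "f v = g v"
proof -
  have "stable I {u \<in> U. f u = g u}"
    using assms by (intro stable_equalizer) (auto simp: stable_irreducible_def)
  then have "{u \<in> U. f u = g u} = {\<zero>\<^bsub>V\<^esub>} \<or> {u \<in> U. f u = g u} = U"
    using assms(1) by (auto simp: stable_irreducible_def)
  then show ?thesis using assms by blast
qed

lemma intertwiner_smult_id: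
  assumes "c \<in> carrier K" and "subspace K U V" and "I \<subseteq> carrier L"
  shows "intertwiner I U (\<lambda>u. c \<odot>\<^bsub>V\<^esub> u)"
  using assms subspaceD(1)[OF assms(2)]
  by (auto simp: intertwiner_def smult_r_distr act_smult_left smult_assoc1[symmetric] lie.R.m_comm subset_iff)

end

text \<open>What the decomposition uses of a direct sum of ideals: two commuting actions without a
  common proper stable subspace. The field stays general, and \<open>eigenvector\<close> stands in
  for algebraic closedness; \<open>complex_eigenvector\<close> provides it over the complex
  numbers.\<close>

locale commuting_actions = lie_module +
  fixes I\<^sub>1 I\<^sub>2
  assumes I_subset: "I\<^sub>1 \<subseteq> carrier L" "I\<^sub>2 \<subseteq> carrier L"
    and commute: "\<lbrakk>v \<in> carrier V; x \<in> I\<^sub>1; y \<in> I\<^sub>2\<rbrakk> \<Longrightarrow> v \<triangleleft>\<^bsub>V\<^esub> x \<triangleleft>\<^bsub>V\<^esub> y = v \<triangleleft>\<^bsub>V\<^esub> y \<triangleleft>\<^bsub>V\<^esub> x"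
    and irreducible: "\<lbrakk>stable I\<^sub>1 X; stable I\<^sub>2 X\<rbrakk> \<Longrightarrow> X = {\<zero>\<^bsub>V\<^esub>} \<or> X = carrier V"
    and fin_dim: "fin_dim"
    and eigenvector: "\<lbrakk>subspace K U V; U \<noteq> {\<zero>\<^bsub>V\<^esub>}; linear_map K (vs U) (vs U) f\<rbrakk>
      \<Longrightarrow> \<exists>u\<in>U. u \<noteq> \<zero>\<^bsub>V\<^esub> \<and> (\<exists>c\<in>carrier K. f u = c \<odot>\<^bsub>V\<^esub> u)"
begin

text \<open>At an eigenvector \<open>f\<close> agrees with multiplication by the eigenvalue. Both
  maps are intertwiners, so \<open>intertwiner_eqI\<close> spreads the agreement over
  \<open>U\<close>.\<close>

lemma schur:
  assumes irr: "stable_irreducible I\<^sub>1 U" and f: "intertwiner I\<^sub>1 U f" "f \<in> U \<rightarrow> U"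
  shows "\<exists>c\<in>carrier K. \<forall>u\<in>U. f u = c \<odot>\<^bsub>V\<^esub> u"
proof -
  have U: "subspace K U V" "U \<noteq> {\<zero>\<^bsub>V\<^esub>}" using irr by (auto simp: stable_irreducible_def stable_def)
  interpret U: vectorspace K "vs U" by (rule subspace_is_vs) fact
  have "linear_map K (vs U) (vs U) f"
    using f U.vectorspace_axioms U.module_axioms
    by (auto simp: linear_map_def mod_hom_def mod_hom_axioms_def LinearCombinations.module_hom_def
        intertwiner_def)
  then obtain u c where "u \<in> U" "u \<noteq> \<zero>\<^bsub>V\<^esub>" "c \<in> carrier K" "f u = c \<odot>\<^bsub>V\<^esub> u"
    using eigenvector U by blast
  then show ?thesis
    using intertwiner_eqI[OF irr I_subset(1) f(1) intertwiner_smult_id] U I_subset by blast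
qed

end

text \<open>The multiplicity space \<open>Hom(U, V)\<close> is realised inside \<open>V\<close> by evaluating an intertwiner
  at the fixed nonzero vector \<open>u\<^sub>0\<close>.\<close>

locale multiplicity_space = commuting_actions +
  fixes U and u\<^sub>0
  assumes U_irreducible: "stable_irreducible I\<^sub>1 U"
    and u0: "u\<^sub>0 \<in> U" "u\<^sub>0 \<noteq> \<zero>\<^bsub>V\<^esub>"
begin

definition W where "W = {f u\<^sub>0 | f. intertwiner I\<^sub>1 U f}"

text \<open>The evaluation pairing: \<open>w\<close> encodes a homomorphism and \<open>B u w\<close>
  is its value at \<open>u\<close>. All candidates for the choice agree on \<open>U\<close>, so the
  value there does not depend on the choice.\<close>

definition B where "B u w = (SOME f. intertwiner I\<^sub>1 U f \<and> f u\<^sub>0 = w) u"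

lemma U_subspace: "subspace K U V" and U_act: "\<lbrakk>u \<in> U; x \<in> I\<^sub>1\<rbrakk> \<Longrightarrow> u \<triangleleft>\<^bsub>V\<^esub> x \<in> U"
  using U_irreducible by (auto simp: stable_irreducible_def stable_def)

lemmas U_closed = subspaceD[OF U_subspace]

lemma U_carrier: "u \<in> U \<Longrightarrow> u \<in> carrier V"
  using U_closed by blast

lemma B_intertwiner:
  assumes "w \<in> W"
  shows "intertwiner I\<^sub>1 U (\<lambda>u. B u w)" and B_u0: "B u\<^sub>0 w = w"
proof -
  let ?f = "SOME f. intertwiner I\<^sub>1 U f \<and> f u\<^sub>0 = w"
  from assms have "\<exists>f. intertwiner I\<^sub>1 U f \<and> f u\<^sub>0 = w" by (auto simp: W_def)
  then have "intertwiner I\<^sub>1 U ?f \<and> ?f u\<^sub>0 = w" by (rule someI_ex)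
  moreover have "(\<lambda>u. B u w) = ?f" by (simp add: B_def)
  ultimately show "intertwiner I\<^sub>1 U (\<lambda>u. B u w)" "B u\<^sub>0 w = w" by (simp_all add: B_def)
qed

text \<open>Frees \<open>B\<close> from the choice operator. Every law in the second argument
  follows by exhibiting an intertwiner with the right value at \<open>u\<^sub>0\<close>.\<close>

lemma B_eqI:
  assumes "intertwiner I\<^sub>1 U f" and "f u\<^sub>0 = w" and "u \<in> U"
  shows "B u w = f u"
proof -
  have w: "w \<in> W" using assms by (auto simp: W_def)
  show ?thesis
    using intertwiner_eqI[OF U_irreducible I_subset(1) B_intertwiner(1)[OF w] assms(1) u0 _ assms(3)]
      B_u0[OF w] assms(2) by simp
qed

lemma in_W_I: "intertwiner I\<^sub>1 U f \<Longrightarrow> f u\<^sub>0 = w \<Longrightarrow> w \<in> W"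
  by (auto simp: W_def)

lemma W_carrier: "w \<in> W \<Longrightarrow> w \<in> carrier V"
  using u0 by (auto simp: W_def intertwiner_def)

lemma B_closed: "\<lbrakk>u \<in> U; w \<in> W\<rbrakk> \<Longrightarrow> B u w \<in> carrier V"
  and B_add_left: "\<lbrakk>u \<in> U; v \<in> U; w \<in> W\<rbrakk> \<Longrightarrow> B (u \<oplus>\<^bsub>V\<^esub> v) w = B u w \<oplus>\<^bsub>V\<^esub> B v w"
  and B_smult_left: "\<lbrakk>c \<in> carrier K; u \<in> U; w \<in> W\<rbrakk> \<Longrightarrow> B (c \<odot>\<^bsub>V\<^esub> u) w = c \<odot>\<^bsub>V\<^esub> B u w"
  and B_act_left: "\<lbrakk>u \<in> U; w \<in> W; x \<in> I\<^sub>1\<rbrakk> \<Longrightarrow> B (u \<triangleleft>\<^bsub>V\<^esub> x) w = B u w \<triangleleft>\<^bsub>V\<^esub> x"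
  using B_intertwiner(1)[of w] by (auto simp: intertwiner_def)

lemma B_zero_left: "w \<in> W \<Longrightarrow> B \<zero>\<^bsub>V\<^esub> w = \<zero>\<^bsub>V\<^esub>"
  using B_smult_left[of "\<zero>\<^bsub>K\<^esub>" "\<zero>\<^bsub>V\<^esub>" w] B_closed[of "\<zero>\<^bsub>V\<^esub>" w] U_closed(2) by simp

lemma intertwiner_B_add:
  assumes "w \<in> W" "w' \<in> W"
  shows "intertwiner I\<^sub>1 U (\<lambda>u. B u w \<oplus>\<^bsub>V\<^esub> B u w')"
  using assms I_subset
  by (auto simp: intertwiner_def B_closed B_add_left B_smult_left B_act_left act_add_left
      smult_r_distr M.a_ac subset_iff)

lemma intertwiner_B_smult:
  assumes "w \<in> W" "c \<in> carrier K"
  shows "intertwiner I\<^sub>1 U (\<lambda>u. c \<odot>\<^bsub>V\<^esub> B u w)"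
  using assms I_subset
  by (auto simp: intertwiner_def B_closed B_add_left B_smult_left B_act_left act_smult_left
      smult_r_distr smult_assoc1[symmetric] lie.R.m_comm subset_iff)

text \<open>Following a homomorphism by the action of \<open>y\<close> gives a homomorphism again,
  because the two actions commute; this lemma is where commutation enters.\<close>

lemma intertwiner_B_act:
  assumes "w \<in> W" "y \<in> I\<^sub>2"
  shows "intertwiner I\<^sub>1 U (\<lambda>u. B u w \<triangleleft>\<^bsub>V\<^esub> y)"
  using assms I_subset
  by (auto simp: intertwiner_def B_closed B_add_left B_smult_left B_act_left act_smult_left
      act_add_left act_closed subset_iff intro!: commute)

lemma W_subspace: "subspace K W V"
proof (rule subspaceI)
  show "W \<subseteq> carrier V" using W_carrier by blast
  show "\<zero>\<^bsub>V\<^esub> \<in> W"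
    by (rule in_W_I[OF intertwiner_smult_id[OF lie.R.zero_closed U_subspace I_subset(1)]])
      (use u0 U_carrier in simp)
  show "w \<oplus>\<^bsub>V\<^esub> w' \<in> W" if "w \<in> W" "w' \<in> W" for w w'
    by (rule in_W_I[OF intertwiner_B_add[OF that]]) (use that in \<open>simp add: B_u0\<close>)
  show "c \<odot>\<^bsub>V\<^esub> w \<in> W" if "c \<in> carrier K" "w \<in> W" for c w
    by (rule in_W_I[OF intertwiner_B_smult[OF that(2,1)]]) (use that in \<open>simp add: B_u0\<close>)
qed

text \<open>The second ideal acts on homomorphisms by composition with its action on
  \<open>V\<close>. Evaluated at \<open>u\<^sub>0\<close>, this is just the action of
  \<open>V\<close>, so \<open>W\<close> is a submodule with the restricted action.\<close>

lemma W_act: "\<lbrakk>w \<in> W; y \<in> I\<^sub>2\<rbrakk> \<Longrightarrow> w \<triangleleft>\<^bsub>V\<^esub> y \<in> W"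
  by (rule in_W_I[OF intertwiner_B_act]) (auto simp: B_u0)

lemma W_stable: "stable I\<^sub>2 W"
  by (simp add: stable_def W_subspace W_act)

lemma B_add_right: "\<lbrakk>u \<in> U; w \<in> W; w' \<in> W\<rbrakk> \<Longrightarrow> B u (w \<oplus>\<^bsub>V\<^esub> w') = B u w \<oplus>\<^bsub>V\<^esub> B u w'"
  by (rule B_eqI[OF intertwiner_B_add]) (auto simp: B_u0)

lemma B_smult_right: "\<lbrakk>c \<in> carrier K; u \<in> U; w \<in> W\<rbrakk> \<Longrightarrow> B u (c \<odot>\<^bsub>V\<^esub> w) = c \<odot>\<^bsub>V\<^esub> B u w"
  by (rule B_eqI[OF intertwiner_B_smult]) (auto simp: B_u0)

lemma B_act_right: "\<lbrakk>u \<in> U; w \<in> W; y \<in> I\<^sub>2\<rbrakk> \<Longrightarrow> B u (w \<triangleleft>\<^bsub>V\<^esub> y) = B u w \<triangleleft>\<^bsub>V\<^esub> y"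
  by (rule B_eqI[OF intertwiner_B_act]) (auto simp: B_u0)

text \<open>The inclusion of \<open>U\<close> into \<open>V\<close> corresponds to
  \<open>u\<^sub>0\<close> itself; this makes \<open>W\<close> nonzero.\<close>

lemma u0_in_W: "u\<^sub>0 \<in> W"
proof (rule in_W_I)
  show "intertwiner I\<^sub>1 U (\<lambda>u. \<one>\<^bsub>K\<^esub> \<odot>\<^bsub>V\<^esub> u)"
    using U_subspace I_subset by (intro intertwiner_smult_id) auto
qed (use u0 U_carrier in simp)

lemma bilinear_map_B: "bilinear_map K (vs U) (vs W) V B"
  using subspace_is_vs[OF U_subspace] subspace_is_vs[OF W_subspace] vectorspace_axioms
  by (simp add: bilinear_map_def bilinear_map_axioms_def B_closed B_add_left B_add_right
      B_smult_left B_smult_right)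

text \<open>The image under evaluation of the tensor that is the sum of all \<open>c w\<close>
  tensor \<open>w\<close>. Injectivity and surjectivity of evaluation become statements about
  \<open>\<sigma>\<close> on a basis of \<open>W\<close>.\<close>

definition \<sigma> where "\<sigma> A c = (\<Oplus>\<^bsub>V\<^esub>w\<in>A. B (c w) w)"

lemma \<sigma>_terms: "\<lbrakk>A \<subseteq> W; c \<in> A \<rightarrow> U\<rbrakk> \<Longrightarrow> (\<lambda>w. B (c w) w) \<in> A \<rightarrow> carrier V"
  by (auto intro!: B_closed)

lemma \<sigma>_closed: "\<lbrakk>A \<subseteq> W; c \<in> A \<rightarrow> U\<rbrakk> \<Longrightarrow> \<sigma> A c \<in> carrier V"
  unfolding \<sigma>_def by (intro M.finsum_closed \<sigma>_terms)

lemma \<sigma>_add: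
  assumes "A \<subseteq> W" "c \<in> A \<rightarrow> U" "d \<in> A \<rightarrow> U"
  shows "\<sigma> A (\<lambda>w. c w \<oplus>\<^bsub>V\<^esub> d w) = \<sigma> A c \<oplus>\<^bsub>V\<^esub> \<sigma> A d"
proof -
  have "\<sigma> A (\<lambda>w. c w \<oplus>\<^bsub>V\<^esub> d w) = (\<Oplus>\<^bsub>V\<^esub>w\<in>A. B (c w) w \<oplus>\<^bsub>V\<^esub> B (d w) w)"
    unfolding \<sigma>_def using assms by (intro M.finsum_cong') (auto intro!: B_closed B_add_left)
  also have "\<dots> = \<sigma> A c \<oplus>\<^bsub>V\<^esub> \<sigma> A d"
    unfolding \<sigma>_def using assms by (intro M.finsum_addf \<sigma>_terms)
  finally show ?thesis .
qed

lemma \<sigma>_smult: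
  assumes "A \<subseteq> W" "c \<in> A \<rightarrow> U" "k \<in> carrier K"
  shows "\<sigma> A (\<lambda>w. k \<odot>\<^bsub>V\<^esub> c w) = k \<odot>\<^bsub>V\<^esub> \<sigma> A c"
proof -
  have "\<sigma> A (\<lambda>w. k \<odot>\<^bsub>V\<^esub> c w) = (\<Oplus>\<^bsub>V\<^esub>w\<in>A. k \<odot>\<^bsub>V\<^esub> B (c w) w)"
    unfolding \<sigma>_def using assms by (intro M.finsum_cong') (auto intro!: B_closed B_smult_left smult_closed)
  also have "\<dots> = k \<odot>\<^bsub>V\<^esub> \<sigma> A c"
    unfolding \<sigma>_def using assms by (intro finsum_smult[symmetric] \<sigma>_terms)
  finally show ?thesis .
qed

lemma \<sigma>_act:
  assumes "A \<subseteq> W" "c \<in> A \<rightarrow> U" "x \<in> I\<^sub>1"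
  shows "\<sigma> A (\<lambda>w. c w \<triangleleft>\<^bsub>V\<^esub> x) = \<sigma> A c \<triangleleft>\<^bsub>V\<^esub> x"
proof -
  have x: "x \<in> carrier L" using assms I_subset by blast
  have "\<sigma> A (\<lambda>w. c w \<triangleleft>\<^bsub>V\<^esub> x) = (\<Oplus>\<^bsub>V\<^esub>w\<in>A. B (c w) w \<triangleleft>\<^bsub>V\<^esub> x)"
    unfolding \<sigma>_def using assms x by (intro M.finsum_cong') (auto intro!: B_closed B_act_left act_closed)
  also have "\<dots> = \<sigma> A c \<triangleleft>\<^bsub>V\<^esub> x"
    unfolding \<sigma>_def using assms x by (intro act_finsum[symmetric] \<sigma>_terms)
  finally show ?thesis .
qed

text \<open>When all left factors are multiples of one vector \<open>u\<close>, bilinearity gathers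
  the scalars on the right. This links relations between values of \<open>\<sigma>\<close> with
  linear combinations in \<open>W\<close>.\<close>

lemma \<sigma>_lincomb:
  assumes "finite A" "A \<subseteq> W" "k \<in> A \<rightarrow> carrier K" "u \<in> U"
  shows "lincomb k A \<in> W" and "\<sigma> A (\<lambda>w. k w \<odot>\<^bsub>V\<^esub> u) = B u (lincomb k A)"
proof -
  have W: "(\<lambda>w. k w \<odot>\<^bsub>V\<^esub> w) \<in> A \<rightarrow> W"
    using assms subspaceD(4)[OF W_subspace] by auto
  then show "lincomb k A \<in> W"
    unfolding lincomb_def by (rule subspace_finsum[OF W_subspace])
  interpret B: bilinear_map K "vs U" "vs W" V B by (rule bilinear_map_B)
  have "B u (lincomb k A) = (\<Oplus>\<^bsub>V\<^esub>w\<in>A. B u (k w \<odot>\<^bsub>V\<^esub> w))"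
    unfolding lincomb_def
    using B.B_finsum_right[of A "\<lambda>w. k w \<odot>\<^bsub>V\<^esub> w" u] assms W W_subspace
      finsum_not_depend[of A W "\<lambda>w. k w \<odot>\<^bsub>V\<^esub> w"] by simp
  also have "\<dots> = \<sigma> A (\<lambda>w. k w \<odot>\<^bsub>V\<^esub> u)"
    unfolding \<sigma>_def using assms
    by (intro M.finsum_cong') (auto simp: B_smult_left B_smult_right Pi_iff subset_iff intro!: B_closed smult_closed)
  finally show "\<sigma> A (\<lambda>w. k w \<odot>\<^bsub>V\<^esub> u) = B u (lincomb k A)" ..
qed

lemma \<sigma>_insert:
  assumes "finite A" "a \<notin> A" "insert a A \<subseteq> W" "c \<in> insert a A \<rightarrow> U"
  shows "\<sigma> (insert a A) c = B (c a) a \<oplus>\<^bsub>V\<^esub> \<sigma> A c"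
  using assms \<sigma>_terms[of A c] by (simp add: \<sigma>_def B_closed)

text \<open>In the induction step the solutions \<open>u\<close> of \<open>B u a + \<Sum>w\<in>A. B (d w) w = 0\<close> form a
  submodule of \<open>U\<close>. If it is all of \<open>U\<close>, then each \<open>d w\<close> is an intertwiner in \<open>u\<close>, hence a scalar
  \<open>k w\<close> by Schur's lemma, and \<open>u = u\<^sub>0\<close> gives the relation \<open>a + \<Sum>w\<in>A. k w \<cdot> w = 0\<close>.\<close>

lemma \<sigma>_eq_zero:
  assumes "finite A" "A \<subseteq> W" "lin_indpt A" "c \<in> A \<rightarrow> U" "\<sigma> A c = \<zero>\<^bsub>V\<^esub>"
  shows "\<forall>w\<in>A. c w = \<zero>\<^bsub>V\<^esub>"
  using assms
proof (induction A arbitrary: c)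
  case (insert a A)
  have a: "a \<in> W" and A: "A \<subseteq> W" "lin_indpt A"
    using insert.prems subset_li_is_li by auto
  define P where "P u d \<longleftrightarrow> d \<in> A \<rightarrow> U \<and> B u a \<oplus>\<^bsub>V\<^esub> \<sigma> A d = \<zero>\<^bsub>V\<^esub>" for u d
  have P_fun: "d \<in> A \<rightarrow> U" if "P u d" for u d
    using that by (simp add: P_def)
  have P_add: "P (u \<oplus>\<^bsub>V\<^esub> v) (\<lambda>w. d w \<oplus>\<^bsub>V\<^esub> e w)" if "P u d" "P v e" "u \<in> U" "v \<in> U" for u v d e
  proof -
    have "B (u \<oplus>\<^bsub>V\<^esub> v) a \<oplus>\<^bsub>V\<^esub> \<sigma> A (\<lambda>w. d w \<oplus>\<^bsub>V\<^esub> e w) =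
        (B u a \<oplus>\<^bsub>V\<^esub> \<sigma> A d) \<oplus>\<^bsub>V\<^esub> (B v a \<oplus>\<^bsub>V\<^esub> \<sigma> A e)"
      using that(3,4) P_fun[OF that(1)] P_fun[OF that(2)] a A
      by (simp add: \<sigma>_add B_add_left B_closed \<sigma>_closed M.a_ac)
    then show ?thesis using that U_closed(3) by (auto simp: P_def)
  qed
  have P_smult: "P (k \<odot>\<^bsub>V\<^esub> u) (\<lambda>w. k \<odot>\<^bsub>V\<^esub> d w)" if "P u d" "u \<in> U" "k \<in> carrier K" for u d k
  proof -
    have "B (k \<odot>\<^bsub>V\<^esub> u) a \<oplus>\<^bsub>V\<^esub> \<sigma> A (\<lambda>w. k \<odot>\<^bsub>V\<^esub> d w) = k \<odot>\<^bsub>V\<^esub> (B u a \<oplus>\<^bsub>V\<^esub> \<sigma> A d)"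
      using that(2,3) P_fun[OF that(1)] a A
      by (simp add: \<sigma>_smult B_smult_left B_closed \<sigma>_closed smult_r_distr)
    then show ?thesis using that U_closed(4) by (auto simp: P_def)
  qed
  have P_act: "P (u \<triangleleft>\<^bsub>V\<^esub> x) (\<lambda>w. d w \<triangleleft>\<^bsub>V\<^esub> x)" if "P u d" "u \<in> U" "x \<in> I\<^sub>1" for u d x
  proof -
    have x: "x \<in> carrier L" using that I_subset by blast
    have "B (u \<triangleleft>\<^bsub>V\<^esub> x) a \<oplus>\<^bsub>V\<^esub> \<sigma> A (\<lambda>w. d w \<triangleleft>\<^bsub>V\<^esub> x) = (B u a \<oplus>\<^bsub>V\<^esub> \<sigma> A d) \<triangleleft>\<^bsub>V\<^esub> x"
      using that(2,3) P_fun[OF that(1)] a A x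
      by (simp add: \<sigma>_act B_act_left B_closed \<sigma>_closed act_add_left)
    moreover have "\<zero>\<^bsub>V\<^esub> \<triangleleft>\<^bsub>V\<^esub> x = \<zero>\<^bsub>V\<^esub>"
      using act_finsum[OF x, of _ "{}"] by simp
    ultimately show ?thesis using that U_act by (auto simp: P_def)
  qed
  \<comment> \<open>The difference of \<open>d\<close> and \<open>e\<close>, written with the scalar
    -1, is a relation over \<open>A\<close> alone, so the induction hypothesis annihilates
    it.\<close>
  have unique: "d w = e w" if d: "P u d" and e: "P u e" and "u \<in> U" "w \<in> A" for u d e w
  proof -
    have UV: "d \<in> A \<rightarrow> U" "e \<in> A \<rightarrow> U" using d e by (auto simp: P_def)
    let ?m = "\<ominus>\<^bsub>K\<^esub> \<one>\<^bsub>K\<^esub>"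
    have mU: "(\<lambda>w. ?m \<odot>\<^bsub>V\<^esub> e w) \<in> A \<rightarrow> U"
      using UV U_closed(4) by (auto simp: Pi_iff)
    have "\<sigma> A d = \<sigma> A e"
      using d e B_closed[OF \<open>u \<in> U\<close> a] \<sigma>_closed[OF A(1)]
      unfolding P_def by (metis M.minus_equality M.minus_minus)
    then have zero: "\<sigma> A (\<lambda>w. d w \<oplus>\<^bsub>V\<^esub> ?m \<odot>\<^bsub>V\<^esub> e w) = \<zero>\<^bsub>V\<^esub>"
      using UV mU A \<sigma>_closed[OF A(1), of e]
      by (simp add: \<sigma>_add \<sigma>_smult smult_minus_1 M.r_neg)
    have closed: "(\<lambda>w. d w \<oplus>\<^bsub>V\<^esub> ?m \<odot>\<^bsub>V\<^esub> e w) \<in> A \<rightarrow> U"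
      using UV mU U_closed(3) by (simp add: Pi_iff)
    have "d w \<oplus>\<^bsub>V\<^esub> ?m \<odot>\<^bsub>V\<^esub> e w = \<zero>\<^bsub>V\<^esub>"
      using bspec[OF insert.IH[OF A closed zero] \<open>w \<in> A\<close>] .
    moreover have "d w \<in> carrier V" "e w \<in> carrier V"
      using UV \<open>w \<in> A\<close> U_carrier by auto
    ultimately show ?thesis
      by (rule eq_if_add_minus_one_smult_zero[rotated 2])
  qed
  define R where "R = {u \<in> U. \<exists>d. P u d}"
  have ca: "c a \<in> U" "c \<in> A \<rightarrow> U" using insert.prems by auto
  have "P (c a) c"
    using insert.prems insert.hyps \<sigma>_insert[of A a c] by (auto simp: P_def)
  then have "c a \<in> R" using ca by (auto simp: R_def)
  have "stable I\<^sub>1 R"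
    unfolding stable_def
  proof (intro conjI ballI subspaceI)
    show "R \<subseteq> carrier V" using U_carrier by (auto simp: R_def)
    show "u \<oplus>\<^bsub>V\<^esub> v \<in> R" if "u \<in> R" "v \<in> R" for u v
      using that P_add U_closed(3) by (fastforce simp: R_def)
    show "k \<odot>\<^bsub>V\<^esub> u \<in> R" if "k \<in> carrier K" "u \<in> R" for k u
      using that P_smult U_closed(4) by (fastforce simp: R_def)
    \<comment> \<open>Zero is obtained as the zero multiple of \<open>c a\<close>, the member of
      \<open>R\<close> already at hand.\<close>
    then show "\<zero>\<^bsub>V\<^esub> \<in> R"
      using \<open>c a \<in> R\<close> ca(1) U_carrier by (metis lie.R.zero_closed lmult_0)
    show "u \<triangleleft>\<^bsub>V\<^esub> x \<in> R" if "u \<in> R" "x \<in> I\<^sub>1" for u x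
      using that P_act U_act by (fastforce simp: R_def)
  qed
  moreover have "R \<subseteq> U" by (auto simp: R_def)
  ultimately consider "R = {\<zero>\<^bsub>V\<^esub>}" | "R = U"
    using U_irreducible by (auto simp: stable_irreducible_def)
  then show ?case
  proof cases
    case 1
    then have "c a = \<zero>\<^bsub>V\<^esub>" using \<open>c a \<in> R\<close> by simp
    moreover from this have "\<sigma> A c = \<zero>\<^bsub>V\<^esub>"
      using \<open>P (c a) c\<close> a A \<sigma>_closed[OF A(1) ca(2)] by (simp add: P_def B_zero_left)
    ultimately show ?thesis using insert.IH A ca(2) by blast
  next
    case 2
    then have "\<forall>u\<in>U. \<exists>d. P u d" by (auto simp: R_def)
    then obtain D where D: "\<And>u. u \<in> U \<Longrightarrow> P u (D u)" by metis
    then have DU: "D u w \<in> U" if "u \<in> U" "w \<in> A" for u w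
      using that by (fastforce simp: P_def)
    have "\<exists>k\<in>carrier K. \<forall>u\<in>U. D u w = k \<odot>\<^bsub>V\<^esub> u" if w: "w \<in> A" for w
    proof (rule schur[OF U_irreducible])
      show "(\<lambda>u. D u w) \<in> U \<rightarrow> U" using DU w by auto
      \<comment> \<open>\<open>D u + D v\<close> is a solution for \<open>u + v\<close> by
        \<open>P_add\<close>, so uniqueness makes the arbitrarily chosen \<open>D\<close> additive.
        Scalars and the action are treated alike.\<close>
      have "D (u \<oplus>\<^bsub>V\<^esub> v) w = D u w \<oplus>\<^bsub>V\<^esub> D v w" if "u \<in> U" "v \<in> U" for u v
        using unique[OF D P_add[OF D D]] U_closed(3) that w by blast
      moreover have "D (k \<odot>\<^bsub>V\<^esub> u) w = k \<odot>\<^bsub>V\<^esub> D u w" if "u \<in> U" "k \<in> carrier K" for u k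
        using unique[OF D P_smult[OF D]] U_closed(4) that w by blast
      moreover have "D (u \<triangleleft>\<^bsub>V\<^esub> x) w = D u w \<triangleleft>\<^bsub>V\<^esub> x" if "u \<in> U" "x \<in> I\<^sub>1" for u x
        using unique[OF D P_act[OF D]] U_act that w by blast
      ultimately show "intertwiner I\<^sub>1 U (\<lambda>u. D u w)"
        using DU w U_carrier by (simp add: intertwiner_def)
    qed
    then obtain k where k: "\<And>w. w \<in> A \<Longrightarrow> k w \<in> carrier K"
      "\<And>w u. w \<in> A \<Longrightarrow> u \<in> U \<Longrightarrow> D u w = k w \<odot>\<^bsub>V\<^esub> u" by metis
    have "\<sigma> A (D u\<^sub>0) = \<sigma> A (\<lambda>w. k w \<odot>\<^bsub>V\<^esub> u\<^sub>0)"
      unfolding \<sigma>_def using k u0 DU A U_closed(4)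
      by (intro M.finsum_cong') (auto intro!: B_closed)
    also have "\<dots> = lincomb k A"
      using \<sigma>_lincomb[of A k u\<^sub>0] insert.hyps A k u0 by (simp add: B_u0)
    finally have "a \<oplus>\<^bsub>V\<^esub> lincomb k A = \<zero>\<^bsub>V\<^esub>"
      using D[OF u0(1)] a by (simp add: P_def B_u0)
    moreover have "lincomb (k(a := \<one>\<^bsub>K\<^esub>)) (insert a A) = a \<oplus>\<^bsub>V\<^esub> lincomb k A"
    proof -
      have "(\<lambda>w. (k(a := \<one>\<^bsub>K\<^esub>)) w \<odot>\<^bsub>V\<^esub> w) \<in> A \<rightarrow> carrier V" "a \<in> carrier V"
        "(\<lambda>w. k w \<odot>\<^bsub>V\<^esub> w) \<in> A \<rightarrow> carrier V"
        using k A a W_carrier by (auto intro!: smult_closed)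
      moreover from this have "(\<Oplus>\<^bsub>V\<^esub>w\<in>A. (k(a := \<one>\<^bsub>K\<^esub>)) w \<odot>\<^bsub>V\<^esub> w) = (\<Oplus>\<^bsub>V\<^esub>w\<in>A. k w \<odot>\<^bsub>V\<^esub> w)"
        using insert.hyps by (intro M.finsum_cong') auto
      ultimately show ?thesis
        using insert.hyps by (simp add: lincomb_def)
    qed
    \<comment> \<open>The coefficient 1 at \<open>a\<close> makes the relation nontrivial, against
      the independence of \<open>insert a A\<close>.\<close>
    ultimately have "lin_dep (insert a A)"
      using insert.hyps k by (intro lin_dep_crit[of "insert a A" _ "k(a := \<one>\<^bsub>K\<^esub>)" a]) auto
    then show ?thesis using insert.prems by blast
  qed
qed simp

text \<open>The sums form a subspace stable under both ideals and not zero, hence all of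
  \<open>V\<close>. The span of \<open>b\<close> may be smaller than \<open>W\<close>: taken equal
  to \<open>W\<close> it gives surjectivity of evaluation, and taken as a nonzero submodule of
  \<open>W\<close> it gives the irreducibility of \<open>W\<close>.\<close>

lemma \<sigma>_spanning:
  assumes b: "finite b" "b \<subseteq> W" and stable: "stable I\<^sub>2 (span b)" and nz: "span b \<noteq> {\<zero>\<^bsub>V\<^esub>}"
    and z: "z \<in> carrier V"
  shows "\<exists>c\<in>b \<rightarrow> U. z = \<sigma> b c"
proof -
  define X where "X = {\<sigma> b c | c. c \<in> b \<rightarrow> U}"
  have bV: "b \<subseteq> carrier V" using b W_carrier by blast
  have B_X: "B u w \<in> X" if u: "u \<in> U" and w: "w \<in> span b" for u w
  proof -
    obtain k where k: "k \<in> b \<rightarrow> carrier K" "lincomb k b = w"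
      using finite_in_span[OF b(1) bV w] by blast
    then have "\<sigma> b (\<lambda>w. k w \<odot>\<^bsub>V\<^esub> u) = B u w"
      using \<sigma>_lincomb(2)[OF b k(1) u] by simp
    moreover have "(\<lambda>w. k w \<odot>\<^bsub>V\<^esub> u) \<in> b \<rightarrow> U"
      using k u U_closed(4) by auto
    ultimately show ?thesis unfolding X_def by force
  qed
  have X: "subspace K X V"
  proof (rule subspaceI)
    show "X \<subseteq> carrier V" using \<sigma>_closed b by (auto simp: X_def)
    show add: "v \<oplus>\<^bsub>V\<^esub> w \<in> X" if vw: "v \<in> X" "w \<in> X" for v w
    proof -
      from vw obtain c d where cd: "c \<in> b \<rightarrow> U" "d \<in> b \<rightarrow> U" "v = \<sigma> b c" "w = \<sigma> b d"
        by (auto simp: X_def)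
      then have "v \<oplus>\<^bsub>V\<^esub> w = \<sigma> b (\<lambda>w. c w \<oplus>\<^bsub>V\<^esub> d w)" "(\<lambda>w. c w \<oplus>\<^bsub>V\<^esub> d w) \<in> b \<rightarrow> U"
        using b U_closed(3) by (auto simp: \<sigma>_add Pi_iff)
      then show ?thesis unfolding X_def by blast
    qed
    show smult: "k \<odot>\<^bsub>V\<^esub> v \<in> X" if k: "k \<in> carrier K" and v: "v \<in> X" for k v
    proof -
      from v obtain c where c: "c \<in> b \<rightarrow> U" "v = \<sigma> b c" by (auto simp: X_def)
      then have "k \<odot>\<^bsub>V\<^esub> v = \<sigma> b (\<lambda>w. k \<odot>\<^bsub>V\<^esub> c w)" "(\<lambda>w. k \<odot>\<^bsub>V\<^esub> c w) \<in> b \<rightarrow> U"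
        using b k U_closed(4) by (auto simp: \<sigma>_smult Pi_iff)
      then show ?thesis unfolding X_def by blast
    qed
    have "\<zero>\<^bsub>V\<^esub> \<in> span b" using span_is_subspace[OF bV] by (rule subspaceD(2))
    then show "\<zero>\<^bsub>V\<^esub> \<in> X"
      using B_X[of "\<zero>\<^bsub>V\<^esub>" "\<zero>\<^bsub>V\<^esub>"] B_zero_left subspaceD(2)[OF W_subspace] U_closed(2) by simp
  qed
  have "stable I\<^sub>1 X"
    unfolding stable_def
  proof (intro conjI ballI)
    fix v x assume v: "v \<in> X" and x: "x \<in> I\<^sub>1"
    from v obtain c where c: "c \<in> b \<rightarrow> U" "v = \<sigma> b c" by (auto simp: X_def)
    then have "v \<triangleleft>\<^bsub>V\<^esub> x = \<sigma> b (\<lambda>w. c w \<triangleleft>\<^bsub>V\<^esub> x)" "(\<lambda>w. c w \<triangleleft>\<^bsub>V\<^esub> x) \<in> b \<rightarrow> U"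
      using b x U_act by (auto simp: \<sigma>_act Pi_iff)
    then show "v \<triangleleft>\<^bsub>V\<^esub> x \<in> X" unfolding X_def by blast
  qed (rule X)
  moreover have "stable I\<^sub>2 X"
    unfolding stable_def
  proof (intro conjI ballI)
    fix v y assume v: "v \<in> X" and y: "y \<in> I\<^sub>2"
    from v obtain c where c: "c \<in> b \<rightarrow> U" "v = \<sigma> b c" by (auto simp: X_def)
    have yL: "y \<in> carrier L" using y I_subset by blast
    have "v \<triangleleft>\<^bsub>V\<^esub> y = (\<Oplus>\<^bsub>V\<^esub>w\<in>b. B (c w) w \<triangleleft>\<^bsub>V\<^esub> y)"
      unfolding c(2) \<sigma>_def using c b yL by (intro act_finsum \<sigma>_terms)
    also have "\<dots> = (\<Oplus>\<^bsub>V\<^esub>w\<in>b. B (c w) (w \<triangleleft>\<^bsub>V\<^esub> y))"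
      using c b y W_act by (intro M.finsum_cong') (auto intro!: B_closed B_act_right[symmetric])
    also have "\<dots> \<in> X"
    \<comment> \<open>Acting with \<open>y\<close> leads out of \<open>b\<close> but not out of its
      span, and \<open>B_X\<close> rewrites such terms as sums over \<open>b\<close> again.\<close>
    proof (rule subspace_finsum[OF X], rule Pi_I)
      fix w assume w: "w \<in> b"
      then have "w \<triangleleft>\<^bsub>V\<^esub> y \<in> span b"
        using stable y in_own_span[OF bV] by (auto simp: stable_def)
      then show "B (c w) (w \<triangleleft>\<^bsub>V\<^esub> y) \<in> X" using B_X c w by auto
    qed
    finally show "v \<triangleleft>\<^bsub>V\<^esub> y \<in> X" .
  qed (rule X)
  ultimately have "X = {\<zero>\<^bsub>V\<^esub>} \<or> X = carrier V" by (rule irreducible)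
  moreover have "X \<noteq> {\<zero>\<^bsub>V\<^esub>}"
  proof -
    have "\<zero>\<^bsub>V\<^esub> \<in> span b" using span_is_subspace[OF bV] by (rule subspaceD(2))
    then obtain w where w: "w \<in> span b" "w \<noteq> \<zero>\<^bsub>V\<^esub>" using nz by blast
    have "span b \<subseteq> W" using b W_subspace by (intro span_is_subset) auto
    then show ?thesis using B_X[OF u0(1) w(1)] w by (auto simp: B_u0 subset_iff)
  qed
  ultimately show ?thesis using z by (auto simp: X_def)
qed

text \<open>Let \<open>b\<close> be a basis of a nonzero submodule \<open>X\<close> and
  \<open>w\<close> outside \<open>X\<close>. Sums over \<open>b\<close> already exhaust
  \<open>V\<close>, so \<open>w\<close> is one of them; but \<open>w\<close> is also
  \<open>B u\<^sub>0 w\<close>, a term over the independent set \<open>insert w b\<close>. The two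
  expressions contradict \<open>\<sigma>_eq_zero\<close>.\<close>

lemma W_irreducible: "stable_irreducible I\<^sub>2 W"
  unfolding stable_irreducible_def
proof (intro conjI allI impI)
  show "W \<noteq> {\<zero>\<^bsub>V\<^esub>}" using u0_in_W u0 by auto
next
  fix X assume X: "stable I\<^sub>2 X" "X \<subseteq> W"
  then obtain b where b: "finite b" "b \<subseteq> X" "lin_indpt b" "span b = X"
    using subspace_basis[OF fin_dim] by (auto simp: stable_def)
  have "w \<in> X" if w: "w \<in> W" and nz: "X \<noteq> {\<zero>\<^bsub>V\<^esub>}" for w
  proof (rule ccontr)
    assume "w \<notin> X"
    then have wb: "w \<notin> b" "w \<notin> span b" using b by auto
    have bV: "b \<subseteq> carrier V" and bW: "b \<subseteq> W" using b X W_carrier by auto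
    have "lin_indpt (insert w b)"
      using lin_dep_iff_in_span[OF bV b(3) W_carrier[OF w] wb(1)] wb by simp
    obtain c where c: "c \<in> b \<rightarrow> U" "w = \<sigma> b c"
      using \<sigma>_spanning[OF b(1) bW _ _ W_carrier[OF w]] b(4) X(1) nz by auto
    \<comment> \<open>The entry at \<open>w\<close> is minus \<open>u\<^sub>0\<close> because
      \<open>B u\<^sub>0 w = w\<close>: it cancels the sum over \<open>b\<close>, which equals
      \<open>w\<close>.\<close>
    define d where "d = c(w := (\<ominus>\<^bsub>K\<^esub> \<one>\<^bsub>K\<^esub>) \<odot>\<^bsub>V\<^esub> u\<^sub>0)"
    have d: "d \<in> insert w b \<rightarrow> U" using c u0 U_closed(4) by (auto simp: d_def)
    have "\<sigma> b d = \<sigma> b c"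
      unfolding \<sigma>_def using c wb bW by (intro M.finsum_cong') (auto simp: d_def intro!: B_closed)
    then have "\<sigma> (insert w b) d = B ((\<ominus>\<^bsub>K\<^esub> \<one>\<^bsub>K\<^esub>) \<odot>\<^bsub>V\<^esub> u\<^sub>0) w \<oplus>\<^bsub>V\<^esub> w"
      using \<sigma>_insert[OF b(1) wb(1) _ d] w bW c(2) by (simp add: d_def)
    also have "\<dots> = \<zero>\<^bsub>V\<^esub>"
      using w u0 W_carrier by (simp add: B_smult_left B_u0 smult_minus_1 M.l_neg)
    finally have "d w = \<zero>\<^bsub>V\<^esub>"
      using \<sigma>_eq_zero[OF _ _ \<open>lin_indpt (insert w b)\<close> d] b(1) bW w by simp
    then have "\<ominus>\<^bsub>V\<^esub> u\<^sub>0 = \<zero>\<^bsub>V\<^esub>"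
      using u0 U_carrier by (simp add: d_def smult_minus_1)
    then show False
      using u0 U_carrier M.r_neg[of u\<^sub>0] by simp
  qed
  then show "X = {\<zero>\<^bsub>V\<^esub>} \<or> X = W" using X by blast
qed (rule W_stable)

end

section \<open>Eigenvectors over the complex numbers\<close>

text \<open>\<open>p(T) u\<close>, by Horner's scheme.\<close>

definition poly_act :: "('k::comm_ring_1, 'v, 'p) module_scheme \<Rightarrow> ('v \<Rightarrow> 'v) \<Rightarrow> 'v \<Rightarrow> 'k poly \<Rightarrow> 'v" where
  "poly_act V T u p = fold_coeffs (\<lambda>a v. a \<odot>\<^bsub>V\<^esub> u \<oplus>\<^bsub>V\<^esub> T v) p \<zero>\<^bsub>V\<^esub>"

text \<open>Eigenvectors are found through the linear map taking a polynomial p to p(T) u for one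
  fixed \<open>u\<close>, without matrices or determinants.\<close>

locale complex_endomorphism = V: vectorspace "class_ring :: complex ring" V for V (structure) +
  fixes T and u
  assumes u_closed: "u \<in> carrier V"
    and T_closed [simp]: "v \<in> carrier V \<Longrightarrow> T v \<in> carrier V"
    and T_add [simp]: "\<lbrakk>v \<in> carrier V; w \<in> carrier V\<rbrakk> \<Longrightarrow> T (v \<oplus> w) = T v \<oplus> T w"
    and T_smult: "v \<in> carrier V \<Longrightarrow> T (c \<odot> v) = c \<odot> T v"
begin

abbreviation P where "P \<equiv> poly_act V T u"

lemma P_0: "P 0 = \<zero>"
  by (simp add: poly_act_def)

lemma smult_0: "v \<in> carrier V \<Longrightarrow> 0 \<odot> v = \<zero>"
  using V.lmult_0[of v] by (simp add: class_ring_simps)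

lemma T_zero [simp]: "T \<zero> = \<zero>"
  using T_smult[of \<zero> 0] by (simp add: smult_0)

lemma smult_closed': "v \<in> carrier V \<Longrightarrow> c \<odot> v \<in> carrier V"
  by (rule V.smult_closed) (simp_all add: class_ring_simps)

lemma smult_distribs:
  "v \<in> carrier V \<Longrightarrow> (c + d) \<odot> v = c \<odot> v \<oplus> d \<odot> v"
  "v \<in> carrier V \<Longrightarrow> w \<in> carrier V \<Longrightarrow> c \<odot> (v \<oplus> w) = c \<odot> v \<oplus> c \<odot> w"
  "v \<in> carrier V \<Longrightarrow> c \<odot> (d \<odot> v) = (c * d) \<odot> v"
  "v \<in> carrier V \<Longrightarrow> 1 \<odot> v = v"
  using V.smult_l_distr[of c d v] V.smult_r_distr[of c v w] V.smult_assoc1[of c d v]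
    V.smult_one[of v]
  by (simp_all add: class_ring_simps)

lemma P_pCons: "P (pCons a p) = a \<odot> u \<oplus> T (P p)"
proof (cases "pCons a p = 0")
  case True
  then show ?thesis using u_closed by (simp add: P_0 smult_0)
next
  case False
  then show ?thesis by (auto simp: poly_act_def fold_coeffs_pCons_not_0_0_eq)
qed

lemma P_closed: "P p \<in> carrier V"
  by (induction p) (simp_all add: P_0 P_pCons smult_closed' u_closed)

lemma P_add: "P (p + q) = P p \<oplus> P q"
proof (induction p q rule: poly_induct2)
  case (pCons a p b q)
  then show ?case
    by (simp add: P_pCons smult_distribs T_smult u_closed P_closed smult_closed' V.a_ac)
qed (simp add: P_0)

lemma P_smult: "P (Polynomial.smult c p) = c \<odot> P p"
proof (induction p)
  case (pCons a p)
  then show ?case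
    by (simp add: P_pCons smult_distribs T_smult u_closed P_closed smult_closed')
qed (use V.rmult_0[of c] in \<open>simp add: P_0 class_ring_simps\<close>)

lemma P_shift: "P (pCons 0 p) = T (P p)"
  by (simp add: P_pCons smult_0 u_closed P_closed)

lemma P_monom: "P (monom 1 n) = (T ^^ n) u"
proof (induction n)
  case (Suc n)
  then show ?case using P_shift[of "monom 1 n"] by (simp add: monom_Suc)
qed (simp add: monom_0 P_pCons P_0 smult_distribs u_closed)

text \<open>Finite dimension forces some power of \<open>T\<close> at \<open>u\<close> into the span
  of the earlier ones, say as q(T) u with q of degree below \<open>i\<close>; then the monomial of
  degree \<open>i\<close> minus q annihilates \<open>u\<close>.\<close>

lemma exists_annihilating_poly:
  assumes "V.fin_dim"
  shows "\<exists>p. p \<noteq> 0 \<and> P p = \<zero>"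
proof -
  define S where "S i = (\<lambda>j. (T ^^ j) u) ` {..<i}" for i
  have T_pow_closed: "(T ^^ j) u \<in> carrier V" for j
    using P_closed[of "monom 1 j"] by (simp add: P_monom)
  then have S_carrier: "S i \<subseteq> carrier V" for i by (auto simp: S_def)
  have "\<exists>i. (T ^^ i) u \<in> V.span (S i)"
  proof (rule ccontr)
    assume none: "\<nexists>i. (T ^^ i) u \<in> V.span (S i)"
    \<comment> \<open>The cardinality is carried along since \<open>S i\<close> is an image and
      could have repetitions; for \<open>i\<close> one above the dimension it is too large.\<close>
    have "V.lin_indpt (S i) \<and> card (S i) = i" for i
    proof (induction i)
      case 0
      then show ?case by (simp add: S_def V.lin_dep_def)
    next
      case (Suc i)
      have "(T ^^ i) u \<notin> S i"
        using none V.in_own_span[OF S_carrier] by blast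
      moreover have "S (Suc i) = insert ((T ^^ i) u) (S i)"
        by (auto simp: S_def lessThan_Suc)
      moreover have "finite (S i)" by (simp add: S_def)
      ultimately show ?case
        using Suc V.lin_dep_iff_in_span[OF S_carrier[of i] _ T_pow_closed[of i]] none by simp
    qed
    then have "Suc V.dim \<le> V.dim"
      using V.li_le_dim(2)[OF assms S_carrier] by metis
    then show False by simp
  qed
  then obtain i where i: "(T ^^ i) u \<in> V.span (S i)" by blast
  \<comment> \<open>Degree less than \<open>i\<close>, expressed by coefficients so that the zero
    polynomial and \<open>i = 0\<close> are covered.\<close>
  let ?X = "{P q | q. \<forall>j\<ge>i. coeff q j = 0}"
  have "subspace class_ring ?X V"
  proof (rule V.subspaceI)
    show "?X \<subseteq> carrier V" by (auto simp: P_closed)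
    show "\<zero> \<in> ?X" by (auto intro!: exI[of _ 0] simp: P_0)
    show "v \<oplus> w \<in> ?X" if vw: "v \<in> ?X" "w \<in> ?X" for v w
    proof -
      from vw obtain p q where "v = P p" "w = P q" "\<forall>j\<ge>i. coeff p j = 0" "\<forall>j\<ge>i. coeff q j = 0"
        by blast
      then show ?thesis by (intro CollectI exI[of _ "p + q"]) (simp add: P_add)
    qed
    show "c \<odot> v \<in> ?X" if v: "v \<in> ?X" for c v
    proof -
      from v obtain p where "v = P p" "\<forall>j\<ge>i. coeff p j = 0" by blast
      then show ?thesis by (intro CollectI exI[of _ "Polynomial.smult c p"]) (simp add: P_smult)
    qed
  qed
  moreover have "S i \<subseteq> ?X"
  proof
    fix v assume "v \<in> S i"
    then obtain j where "j < i" "v = P (monom 1 j)" by (auto simp: S_def P_monom)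
    then show "v \<in> ?X" by (intro CollectI exI[of _ "monom 1 j"]) simp
  qed
  ultimately have "V.span (S i) \<subseteq> ?X"
    by (intro V.span_is_subset) auto
  then obtain q where q: "(T ^^ i) u = P q" "\<forall>j\<ge>i. coeff q j = 0" using i by blast
  let ?p = "monom 1 i + Polynomial.smult (- 1) q"
  have "coeff ?p i \<noteq> 0" using q by simp
  then have "?p \<noteq> 0" by (metis coeff_0)
  moreover have "P ?p = P q \<oplus> (- 1) \<odot> P q"
    by (simp only: P_add P_smult P_monom q(1))
  then have "P ?p = \<zero>"
    using smult_distribs(1)[of "P q" 1 "- 1"] by (simp add: smult_distribs(4) smult_0 P_closed)
  ultimately show ?thesis by blast
qed

text \<open>Split a root \<open>c\<close> off an annihilating polynomial of least degree, leaving
  the factor q. By minimality q(T) u is nonzero, and \<open>T - c\<close> kills it, so it is an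
  eigenvector.\<close>

lemma exists_eigenvector:
  assumes "V.fin_dim" and "u \<noteq> \<zero>"
  shows "\<exists>v\<in>carrier V. v \<noteq> \<zero> \<and> (\<exists>c. T v = c \<odot> v)"
proof -
  let ?A = "\<lambda>p. p \<noteq> 0 \<and> P p = \<zero>"
  obtain p where p: "?A p" and min: "\<And>q. ?A q \<Longrightarrow> degree p \<le> degree q"
    using ex_has_least_nat[of ?A _ degree] exists_annihilating_poly[OF assms(1)] by metis
  \<comment> \<open>A nonzero constant cannot annihilate the nonzero vector \<open>u\<close>, so
    there is a root to split off.\<close>
  have "degree p \<noteq> 0"
  proof
    assume "degree p = 0"
    then obtain a where a: "p = [:a:]" by (rule degree_eq_zeroE)
    then have "a \<noteq> 0" "a \<odot> u = \<zero>"
      using p u_closed by (auto simp: P_pCons P_0 smult_closed')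
    then have "inverse a \<odot> (a \<odot> u) = inverse a \<odot> \<zero>" by simp
    then show False
      using \<open>a \<noteq> 0\<close> u_closed assms(2) V.rmult_0[of "inverse a"]
      by (simp add: smult_distribs class_ring_simps)
  qed
  then obtain c where "poly p c = 0"
    using fundamental_theorem_of_algebra[of p] by (auto simp: constant_degree)
  then obtain q where q: "p = [:- c, 1:] * q"
    using poly_eq_0_iff_dvd by blast
  have "q \<noteq> 0" using p q by auto
  then have "degree q < degree p"
    unfolding q by (subst degree_mult_eq) auto
  then have "P q \<noteq> \<zero>" using min \<open>q \<noteq> 0\<close> by fastforce
  have "p = Polynomial.smult (- c) q + pCons 0 q"
    unfolding q by simp
  then have "(- c) \<odot> P q \<oplus> T (P q) = \<zero>"
    using p by (metis P_add P_smult P_shift)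
  moreover have "c \<odot> P q \<oplus> ((- c) \<odot> P q \<oplus> T (P q)) = T (P q)"
  proof -
    have "c \<odot> P q \<oplus> (- c) \<odot> P q = \<zero>"
      using smult_distribs(1)[of "P q" c "- c"] by (simp add: P_closed smult_0)
    then show ?thesis
      by (simp add: P_closed smult_closed' flip: V.a_assoc)
  qed
  ultimately have "T (P q) = c \<odot> P q"
    by (simp add: smult_closed' P_closed)
  with \<open>P q \<noteq> \<zero>\<close> P_closed show ?thesis by blast
qed

end

lemma complex_eigenvector:
  fixes V :: "(complex, 'v, 'p) module_scheme" (structure)
  assumes "linear_map class_ring V V T" and "vectorspace.fin_dim class_ring V"
    and "carrier V \<noteq> {\<zero>}"
  shows "\<exists>v\<in>carrier V. v \<noteq> \<zero> \<and> (\<exists>c. T v = c \<odot> v)"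
proof -
  interpret T: linear_map class_ring V V T by fact
  have "\<zero> \<in> carrier V" by simp
  then obtain u where u: "u \<in> carrier V" "u \<noteq> \<zero>" using assms(3) by blast
  interpret complex_endomorphism V T u
    using u by unfold_locales (simp_all add: class_ring_simps)
  show ?thesis using exists_eigenvector[OF assms(2) u(2)] .
qed

section \<open>Direct sums of Lie algebras\<close>

lemma (in lie_algebra) lie_algebra_ideal:
  assumes "lie_ideal K I L"
  shows "lie_algebra K (L\<lparr>carrier := I\<rparr>)"
proof -
  have I: "subspace K I L" "\<And>x y. \<lbrakk>x \<in> I; y \<in> carrier L\<rbrakk> \<Longrightarrow> \<lblot>x, y\<rblot> \<in> I"
    using assms by (auto simp: lie_ideal_def)
  have sub: "\<And>x. x \<in> I \<Longrightarrow> x \<in> carrier L"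
    using subspaceD(1)[OF I(1)] by blast
  show ?thesis
    by (intro lie_algebra.intro lie_algebra_axioms.intro subspace_is_vs I(1))
      (simp_all add: I(2) sub bracket_add_left bracket_add_right bracket_smult_left
        bracket_smult_right bracket_self jacobi)
qed

context lie_module
begin

lemma act_zero:
  assumes "v \<in> carrier V"
  shows "v \<triangleleft>\<^bsub>V\<^esub> \<zero>\<^bsub>L\<^esub> = \<zero>\<^bsub>V\<^esub>"
  using act_smult_right[of "\<zero>\<^bsub>K\<^esub>" v "\<zero>\<^bsub>L\<^esub>"] act_closed[of v "\<zero>\<^bsub>L\<^esub>"] assms by simp

lemma lie_module_restrict:
  assumes "lie_ideal K I L" and "stable I U"
  shows "lie_module K (L\<lparr>carrier := I\<rparr>) (V\<lparr>carrier := U\<rparr>)"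
proof -
  have U: "subspace K U V" "\<And>v x. \<lbrakk>v \<in> U; x \<in> I\<rbrakk> \<Longrightarrow> v \<triangleleft>\<^bsub>V\<^esub> x \<in> U"
    using assms(2) by (auto simp: stable_def)
  have sub: "\<And>v. v \<in> U \<Longrightarrow> v \<in> carrier V" "\<And>x. x \<in> I \<Longrightarrow> x \<in> carrier L"
    using subspaceD(1)[OF U(1)] assms(1) by (auto simp: lie_ideal_def subspace_def submodule_def)
  show ?thesis
    by (intro lie_module.intro lie_module_axioms.intro lie.lie_algebra_ideal assms(1)
        subspace_is_vs U(1))
      (simp_all add: U(2) sub act_add_left act_add_right act_smult_left act_smult_right
        act_bracket minus_subspace[OF U(1)])
qed

text \<open>Submodules of the restricted module are exactly the stable subspaces contained in
  \<open>U\<close>, so the internal notion of irreducibility yields the official one.\<close>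

lemma irreducible_lie_module_restrict:
  assumes "lie_ideal K I L" and irr: "stable_irreducible I U"
  shows "irreducible_lie_module K (L\<lparr>carrier := I\<rparr>) (V\<lparr>carrier := U\<rparr>)"
  unfolding irreducible_lie_module_def
proof (intro conjI allI impI)
  have U: "stable I U" "subspace K U V" using irr by (auto simp: stable_irreducible_def stable_def)
  then show "lie_module K (L\<lparr>carrier := I\<rparr>) (V\<lparr>carrier := U\<rparr>)"
    using assms(1) by (intro lie_module_restrict)
  show "carrier (V\<lparr>carrier := U\<rparr>) \<noteq> {\<zero>\<^bsub>V\<lparr>carrier := U\<rparr>\<^esub>}"
    using irr by (simp add: stable_irreducible_def)
  fix X assume X: "lie_submodule K (L\<lparr>carrier := I\<rparr>) X (V\<lparr>carrier := U\<rparr>)"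
  then have "subspace K X (V\<lparr>carrier := U\<rparr>)" by (simp add: lie_submodule_def)
  then have "stable I X" "X \<subseteq> U"
    using X subspace_of_vs[OF _ U(2)] by (auto simp: stable_def lie_submodule_def)
  then show "X = {\<zero>\<^bsub>V\<lparr>carrier := U\<rparr>\<^esub>} \<or> X = carrier (V\<lparr>carrier := U\<rparr>)"
    using irr by (simp add: stable_irreducible_def)
qed

end

text \<open>The bracket lies in both ideals. Since \<open>lie_ideal\<close> absorbs from one side
  only, membership in the second needs antisymmetry, obtained by expanding the bracket of
  \<open>x + y\<close> with itself.\<close>

lemma (in lie_direct_sum) bracket_summands:
  assumes "x \<in> I\<^sub>1" and "y \<in> I\<^sub>2"
  shows "\<lblot>x, y\<rblot> = \<zero>"
proof -
  have I: "subspace K I\<^sub>1 L" "subspace K I\<^sub>2 L"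
    using ideal1 ideal2 by (auto simp: lie_ideal_def)
  have xy: "x \<in> carrier L" "y \<in> carrier L"
    using assms subspaceD(1)[OF I(1)] subspaceD(1)[OF I(2)] by auto
  have "\<lblot>x \<oplus> y, x \<oplus> y\<rblot> = \<lblot>x, y\<rblot> \<oplus> \<lblot>y, x\<rblot>"
    using xy by (simp add: bracket_add_left bracket_add_right bracket_closed
        bracket_self[of x] bracket_self[of y] M.a_comm)
  moreover have "\<lblot>x \<oplus> y, x \<oplus> y\<rblot> = \<zero>"
    using xy by (intro bracket_self) simp
  ultimately have "\<lblot>x, y\<rblot> \<oplus> \<lblot>y, x\<rblot> = \<zero>"
    by simp
  then have "\<lblot>x, y\<rblot> = (\<ominus>\<^bsub>K\<^esub> \<one>\<^bsub>K\<^esub>) \<odot> \<lblot>y, x\<rblot>"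
    using xy by (simp add: smult_minus_1 bracket_closed M.minus_equality)
  moreover have "\<lblot>y, x\<rblot> \<in> I\<^sub>2"
    using ideal2 assms xy by (simp add: lie_ideal_def)
  ultimately have "\<lblot>x, y\<rblot> \<in> I\<^sub>2"
    using subspaceD(4)[OF I(2)] by simp
  moreover have "\<lblot>x, y\<rblot> \<in> I\<^sub>1"
    using ideal1 assms xy by (simp add: lie_ideal_def)
  ultimately show ?thesis using int_zero by blast
qed

theorem theorem3p1:
  fixes G :: "(complex, 'g) lie_algebra" and G\<^sub>1 G\<^sub>2 :: "'g set"
    and V :: "(complex, 'g, 'v) lie_module"
  assumes "lie_direct_sum class_ring G G\<^sub>1 G\<^sub>2"
    and "vectorspace.fin_dim class_ring (G\<lparr>carrier := G\<^sub>1\<rparr>)"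
    and "vectorspace.fin_dim class_ring (G\<lparr>carrier := G\<^sub>2\<rparr>)"
    and "irreducible_lie_module class_ring G V"
    and "vectorspace.fin_dim class_ring V"
    and "vectorspace.dim class_ring V > 1"
  shows "\<exists>(V\<^sub>1 :: (complex, 'g, 'v) lie_module) (V\<^sub>2 :: (complex, 'g, 'v) lie_module).
           irreducible_lie_module class_ring (G\<lparr>carrier := G\<^sub>1\<rparr>) V\<^sub>1 \<and>
           vectorspace.fin_dim class_ring V\<^sub>1 \<and>
           irreducible_lie_module class_ring (G\<lparr>carrier := G\<^sub>2\<rparr>) V\<^sub>2 \<and>
           vectorspace.fin_dim class_ring V\<^sub>2 \<and>
           lie_module_isomorphic class_ring G V (tensor_module class_ring G G\<^sub>1 G\<^sub>2 V\<^sub>1 V\<^sub>2)"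
proof -
  interpret G: lie_direct_sum class_ring G G\<^sub>1 G\<^sub>2 by fact
  have V: "lie_module class_ring G V" "carrier V \<noteq> {\<zero>\<^bsub>V\<^esub>}"
    "\<And>X. lie_submodule class_ring G X V \<Longrightarrow> X = {\<zero>\<^bsub>V\<^esub>} \<or> X = carrier V"
    using assms(4) by (auto simp: irreducible_lie_module_def)
  interpret V: lie_module class_ring G V by fact
  have sub: "subspace class_ring G\<^sub>1 G" "subspace class_ring G\<^sub>2 G"
    using G.ideal1 G.ideal2 by (auto simp: lie_ideal_def)
  note G_sub = G.subspaceD(1)[OF sub(1)] G.subspaceD(1)[OF sub(2)]
  obtain U where U: "V.stable_irreducible G\<^sub>1 U"
    using V.exists_stable_irreducible[OF assms(5) V(2) G_sub(1)] .
  then have "subspace class_ring U V" "U \<noteq> {\<zero>\<^bsub>V\<^esub>}"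
    by (auto simp: V.stable_irreducible_def V.stable_def)
  then obtain u\<^sub>0 where u0: "u\<^sub>0 \<in> U" "u\<^sub>0 \<noteq> \<zero>\<^bsub>V\<^esub>"
    using V.subspaceD(2) by blast
  interpret multiplicity_space class_ring G V G\<^sub>1 G\<^sub>2 U u\<^sub>0
  proof
    show "v \<triangleleft>\<^bsub>V\<^esub> x \<triangleleft>\<^bsub>V\<^esub> y = v \<triangleleft>\<^bsub>V\<^esub> y \<triangleleft>\<^bsub>V\<^esub> x"
      if v: "v \<in> carrier V" and x: "x \<in> G\<^sub>1" and y: "y \<in> G\<^sub>2" for v x y
    proof -
      have xy: "x \<in> carrier G" "y \<in> carrier G" using x y G_sub by auto
      have "v \<triangleleft>\<^bsub>V\<^esub> \<zero>\<^bsub>G\<^esub> = \<zero>\<^bsub>V\<^esub>"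
        using v by (rule V.act_zero)
      \<comment> \<open>Acting by the bracket of \<open>x\<close> and \<open>y\<close>, which is
        zero, gives the commutator of their actions.\<close>
      then have "v \<triangleleft>\<^bsub>V\<^esub> x \<triangleleft>\<^bsub>V\<^esub> y \<ominus>\<^bsub>V\<^esub> v \<triangleleft>\<^bsub>V\<^esub> y \<triangleleft>\<^bsub>V\<^esub> x = \<zero>\<^bsub>V\<^esub>"
        using V.act_bracket[OF v xy] G.bracket_summands[OF x y] by simp
      then show ?thesis using v xy V.act_closed by simp
    qed
    show "X = {\<zero>\<^bsub>V\<^esub>} \<or> X = carrier V" if X: "V.stable G\<^sub>1 X" "V.stable G\<^sub>2 X" for X
    proof (rule V(3))
      have Xs: "subspace class_ring X V" using X by (simp add: V.stable_def)
      have "v \<triangleleft>\<^bsub>V\<^esub> x \<in> X" if v: "v \<in> X" and "x \<in> carrier G" for v x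
      proof -
        obtain y z where yz: "y \<in> G\<^sub>1" "z \<in> G\<^sub>2" "x = y \<oplus>\<^bsub>G\<^esub> z"
          using \<open>x \<in> carrier G\<close> unfolding G.sum_eq[symmetric] set_add_def' by blast
        then have "v \<triangleleft>\<^bsub>V\<^esub> x = v \<triangleleft>\<^bsub>V\<^esub> y \<oplus>\<^bsub>V\<^esub> v \<triangleleft>\<^bsub>V\<^esub> z"
          using v V.subspaceD(1)[OF Xs] G_sub by (auto intro!: V.act_add_right)
        then show ?thesis
          using X v yz V.subspaceD(3)[OF Xs] by (simp add: V.stable_def)
      qed
      then show "lie_submodule class_ring G X V"
        using Xs by (simp add: lie_submodule_def)
    qed
    show "\<exists>u\<in>X. u \<noteq> \<zero>\<^bsub>V\<^esub> \<and> (\<exists>c\<in>carrier class_ring. f u = c \<odot>\<^bsub>V\<^esub> u)"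
      if "subspace class_ring X V" "X \<noteq> {\<zero>\<^bsub>V\<^esub>}"
        "linear_map class_ring (V\<lparr>carrier := X\<rparr>) (V\<lparr>carrier := X\<rparr>) f" for X f
      using complex_eigenvector[OF that(3) V.fin_dim_subspace[OF assms(5) that(1)]] that(2)
      by (simp add: class_ring_simps)
  qed (use G_sub assms(5) U u0 in auto)
  \<comment> \<open>A basis of \<open>W\<close> is the generating set for the tensor criterion: its
    span gives surjectivity of evaluation, its independence injectivity.\<close>
  obtain b where b: "finite b" "b \<subseteq> W" "V.lin_indpt b" "V.span b = W"
    using V.subspace_basis[OF assms(5) W_subspace] .
  have "lie_module_isomorphic class_ring G V
      (tensor_module class_ring G G\<^sub>1 G\<^sub>2 (V\<lparr>carrier := U\<rparr>) (V\<lparr>carrier := W\<rparr>))"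
  proof (rule tensor_module_isomorphic[OF assms(1) V(1) bilinear_map_B])
    show "finite b" by fact
    show "LinearCombinations.module.span class_ring (V\<lparr>carrier := W\<rparr>) b = carrier (V\<lparr>carrier := W\<rparr>)"
      using V.span_li_not_depend(1)[OF b(2)] W_subspace b(4) by simp
    show "\<exists>c\<in>b \<rightarrow> carrier (V\<lparr>carrier := U\<rparr>). z = (\<Oplus>\<^bsub>V\<^esub>w\<in>b. B (c w) w)" if "z \<in> carrier V" for z
      using \<sigma>_spanning[OF b(1,2) _ _ that] b(4) W_stable u0_in_W u0 by (auto simp: \<sigma>_def)
    show "\<forall>w\<in>b. c w = \<zero>\<^bsub>V\<lparr>carrier := U\<rparr>\<^esub>"
      if "c \<in> b \<rightarrow> carrier (V\<lparr>carrier := U\<rparr>)" "(\<Oplus>\<^bsub>V\<^esub>w\<in>b. B (c w) w) = \<zero>\<^bsub>V\<^esub>" for c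
      using \<sigma>_eq_zero[OF b(1-3)] that by (simp add: \<sigma>_def)
  qed (use b(2) U_act W_act B_act_left B_act_right in auto)
  moreover have "irreducible_lie_module class_ring (G\<lparr>carrier := G\<^sub>1\<rparr>) (V\<lparr>carrier := U\<rparr>)"
    using G.ideal1 U by (rule V.irreducible_lie_module_restrict)
  moreover have "irreducible_lie_module class_ring (G\<lparr>carrier := G\<^sub>2\<rparr>) (V\<lparr>carrier := W\<rparr>)"
    using G.ideal2 W_irreducible by (rule V.irreducible_lie_module_restrict)
  moreover have "vectorspace.fin_dim class_ring (V\<lparr>carrier := U\<rparr>)"
    "vectorspace.fin_dim class_ring (V\<lparr>carrier := W\<rparr>)"
    using V.fin_dim_subspace[OF assms(5)] U_subspace W_subspace by blast+
  ultimately show ?thesis by blast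
qed

end
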